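(* Let $k$ be a field of characteristic zero, $n\ge1$, and let $A=A_n(k)$ denote the $n$-th Weyl algebra over $k$. If $f$ is a $k$-algebra endomorphism of $A$, then the graph $A^f$ and the dual graph ${}^fA$ are holonomic and simple bimodules over $A$.
   Context: For a field $k$, the Weyl algebra $A_n(k)$ is the $k$-algebra generated by $x_1,\dots,x_n,\partial_1,\dots,\partial_n$ with relations $[x_i,x_j]=0$, $[\partial_i,\partial_j]=0$, $[\partial_i,x_j]=\delta_{ij}$. The monomials $x^\alpha\partial^\beta$ ($\alpha,\beta\in\mathbb{N}^n$) form a $k$-basis; the degree of $x^\alpha\partial^\beta$ is $|\alpha|+|\beta|$, and $B^n_m$ denotes the $k$-span of monomials of degree $\le m$ (Bernstein filtration). A bimodule over a $k$-algebra $A$ is a $k$-vector space $M$ with left and right $A$-module structures compatible with the $k$-vector space structure such that $(a_1m)a_2=a_1(ma_2)$. For a $k$-algebra endomorphism $f:A\to A$, the graph $A^f$ is the vector space $A$ with bimodule structure $a\cdot x\cdot s=a\,x\,f(s)$, and the dual graph ${}^fA$ is the vector space $A$ with bimodule structure $a\cdot x\cdot s=f(a)\,x\,s$ ($a,x,s\in A$). Bimodules over $A_n(k)$ are identified with left $A_{2n}(k)$-modules via $x_i\cdot m=x_im$, $\partial_i\cdot m=\partial_i m$, $x_{n+i}\cdot m=mx_i$, $\partial_{n+i}\cdot m=-m\partial_i$ for $1\le i\le n$. For $k$ of characteristic zero and a finitely generated left $A_N(k)$-module $M\ne0$ with finite generating set $m_1,\dots,m_r$, put $\Gamma_i=B^N_im_1+\cdots+B^N_im_r$.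 For $i\gg0$, $\dim_k\Gamma_i$ equals $p(i)$ for a polynomial $p=\frac{e}{d!}x^d+\cdots$, where $d=\dim(M)$ (the dimension) and $e$ are independent of the choice of generators. $M$ is called holonomic if it is finitely generated and either $M=0$ or $\dim(M)=N$. A bimodule over $A_n(k)$ is called holonomic if it is holonomic as a left $A_{2n}(k)$-module. *)

theory Defs
  imports "HOL-Library.Poly_Mapping" "HOL-Library.Function_Algebras" "HOL-Computational_Algebra.Polynomial"
begin

section \<open>Free algebras and two-sided ideals\<close>

text \<open>
  A copy of lists that carries the structure of the free monoid, written additively so that
  functions of finite support on it form the free algebra \<open>k\<langle>'g\<rangle>\<close> under the convolution product
  of \<open>HOL-Library.Poly_Mapping\<close>.
\<close>

datatype 'g free_monoid = Free_Monoid (letters: "'g list")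

instantiation free_monoid :: (type) monoid_add
begin

definition zero_free_monoid :: "'a free_monoid"
  where "0 = Free_Monoid []"

definition plus_free_monoid :: "'a free_monoid \<Rightarrow> 'a free_monoid \<Rightarrow> 'a free_monoid"
  where "v + w = Free_Monoid (letters v @ letters w)"

instance
  by standard (simp_all add: zero_free_monoid_def plus_free_monoid_def)

end

type_synonym ('g, 'k) free_algebra = "'g free_monoid \<Rightarrow>\<^sub>0 'k"

definition free_gen :: "'g \<Rightarrow> ('g, 'k::comm_ring_1) free_algebra"
  where "free_gen g = Poly_Mapping.single (Free_Monoid [g]) 1"

definition free_const :: "'k::comm_ring_1 \<Rightarrow> ('g, 'k) free_algebra"
  where "free_const c = Poly_Mapping.single 0 c"

inductive_set two_sided_ideal :: "'a::ring_1 set \<Rightarrow> 'a set" for R :: "'a set" where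
  ideal_zero: "0 \<in> two_sided_ideal R"
| ideal_gen: "r \<in> R \<Longrightarrow> a * r * b \<in> two_sided_ideal R"
| ideal_add: "u \<in> two_sided_ideal R \<Longrightarrow> v \<in> two_sided_ideal R \<Longrightarrow> u + v \<in> two_sided_ideal R"

lemma ideal_mult_left: "u \<in> two_sided_ideal R \<Longrightarrow> c * u \<in> two_sided_ideal R"
proof (induction rule: two_sided_ideal.induct)
  case (ideal_gen r a b)
  then show ?case
    using two_sided_ideal.ideal_gen[of r R "c * a" b] by (simp add: mult.assoc)
qed (auto simp: distrib_left intro: two_sided_ideal.intros)

lemma ideal_mult_right: "u \<in> two_sided_ideal R \<Longrightarrow> u * c \<in> two_sided_ideal R"
proof (induction rule: two_sided_ideal.induct)
  case (ideal_gen r a b)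
  then show ?case
    using two_sided_ideal.ideal_gen[of r R a "b * c"] by (simp add: mult.assoc)
qed (auto simp: distrib_right intro: two_sided_ideal.intros)

lemma ideal_uminus: "u \<in> two_sided_ideal R \<Longrightarrow> - u \<in> two_sided_ideal R"
  using ideal_mult_left[of u R "- 1"] by simp

lemma ideal_diff:
  "u \<in> two_sided_ideal R \<Longrightarrow> v \<in> two_sided_ideal R \<Longrightarrow> u - v \<in> two_sided_ideal R"
  using two_sided_ideal.ideal_add[OF _ ideal_uminus] by fastforce


section \<open>Operators satisfying the Weyl relations\<close>

datatype 'n weyl_gen = Var 'n | Der 'n

definition weyl_relators :: "('n weyl_gen, 'k::comm_ring_1) free_algebra set" where
  "weyl_relators =
     (\<Union>i j. {free_gen (Var i) * free_gen (Var j) - free_gen (Var j) * free_gen (Var i),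
             free_gen (Der i) * free_gen (Der j) - free_gen (Der j) * free_gen (Der i),
             free_gen (Der i) * free_gen (Var j) - free_gen (Var j) * free_gen (Der i)
               - (if i = j then 1 else 0)})"

locale weyl_operators = vector_space scale
  for scale :: "'k::field \<Rightarrow> 'm::ab_group_add \<Rightarrow> 'm" +
  fixes X D :: "'n \<Rightarrow> 'm \<Rightarrow> 'm"
  assumes X_add: "X i (u + v) = X i u + X i v"
    and D_add: "D i (u + v) = D i u + D i v"
    and X_scale: "X i (scale c u) = scale c (X i u)"
    and D_scale: "D i (scale c u) = scale c (D i u)"
    and X_X: "X i (X j u) = X j (X i u)"
    and D_D: "D i (D j u) = D j (D i u)"
    and D_X: "D i (X j u) = X j (D i u) + (if i = j then u else 0)"
begin

definition gen_op :: "'n weyl_gen \<Rightarrow> 'm \<Rightarrow> 'm"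
  where "gen_op g = (case g of Var i \<Rightarrow> X i | Der i \<Rightarrow> D i)"

definition word_op :: "'n weyl_gen free_monoid \<Rightarrow> 'm \<Rightarrow> 'm"
  where "word_op w = foldr gen_op (letters w)"

definition free_op :: "('n weyl_gen, 'k) free_algebra \<Rightarrow> 'm \<Rightarrow> 'm"
  where "free_op p u = (\<Sum>w\<in>Poly_Mapping.keys p. scale (Poly_Mapping.lookup p w) (word_op w u))"

lemma gen_op_add: "gen_op g (u + v) = gen_op g u + gen_op g v"
  by (cases g) (simp_all add: gen_op_def X_add D_add)

lemma gen_op_scale: "gen_op g (scale c u) = scale c (gen_op g u)"
  by (cases g) (simp_all add: gen_op_def X_scale D_scale)

lemma foldr_gen_op_add: "foldr gen_op gs (u + v) = foldr gen_op gs u + foldr gen_op gs v"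
  by (induction gs) (simp_all add: gen_op_add)

lemma foldr_gen_op_scale: "foldr gen_op gs (scale c u) = scale c (foldr gen_op gs u)"
  by (induction gs) (simp_all add: gen_op_scale)

lemma word_op_plus: "word_op (v + w) u = word_op v (word_op w u)"
  by (simp add: word_op_def plus_free_monoid_def)

lemma free_op_right_add: "free_op p (u + v) = free_op p u + free_op p v"
  by (simp add: free_op_def word_op_def foldr_gen_op_add scale_right_distrib sum.distrib)

lemma free_op_right_scale: "free_op p (scale c u) = scale c (free_op p u)"
  by (simp add: free_op_def word_op_def foldr_gen_op_scale scale_sum_right mult.commute)

lemma free_op_add: "free_op (p + q) u = free_op p u + free_op q u"
  unfolding free_op_def
  by (rule setsum_keys_plus_distrib) (simp_all add: scale_left_distrib)

lemma free_op_zero: "free_op 0 u = 0"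
  by (simp add: free_op_def)

lemma free_op_single: "free_op (Poly_Mapping.single w c) u = scale c (word_op w u)"
  by (cases "c = 0") (simp_all add: free_op_def)

lemma free_op_diff: "free_op (p - q) u = free_op p u - free_op q u"
  using free_op_add[of "p - q" q u] by simp

lemma free_op_const: "free_op (free_const c) u = scale c u"
  by (simp add: free_const_def free_op_single word_op_def zero_free_monoid_def)

lemma free_op_one: "free_op 1 u = u"
  using free_op_const[of 1 u] by (simp add: free_const_def)

lemma free_op_gen: "free_op (free_gen g) u = gen_op g u"
  by (simp add: free_gen_def free_op_single word_op_def)

end

lemma free_algebra_induct [case_names single add]:
  fixes p :: "'a \<Rightarrow>\<^sub>0 'k::comm_ring_1"
  assumes single: "\<And>w c. P (Poly_Mapping.single w c)"
    and add: "\<And>p q. P p \<Longrightarrow> P q \<Longrightarrow> P (p + q)"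
  shows "P p"
proof (induction p rule: update_induct)
  case const
  show ?case using single[of undefined 0] by simp
next
  case (update p w c)
  have "Poly_Mapping.update w c p = Poly_Mapping.single w c + p"
    using update(1)
    by (intro poly_mapping_eqI)
      (auto simp: lookup_update lookup_add lookup_single when_def in_keys_iff)
  then show ?case using single add update by metis
qed

context weyl_operators
begin

lemma free_op_mult: "free_op (p * q) u = free_op p (free_op q u)"
proof (induction p rule: free_algebra_induct)
  case (single v c)
  show ?case
  proof (induction q rule: free_algebra_induct)
    case (single w d)
    then show ?case
      by (simp add: mult_single free_op_single word_op_plus)
        (simp add: word_op_def foldr_gen_op_scale)
  qed (simp add: distrib_left free_op_add free_op_right_add)
qed (simp add: distrib_right free_op_add)

lemma free_op_right_zero: "free_op p 0 = 0"
  using free_op_right_add[of p 0 0] by simp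

lemma free_op_relator:
  assumes "r \<in> weyl_relators"
  shows "free_op r u = 0"
  using assms
  by (auto simp: weyl_relators_def free_op_diff free_op_mult free_op_gen gen_op_def
      free_op_one free_op_zero X_X D_D D_X split: if_splits)

lemma free_op_ideal: "r \<in> two_sided_ideal weyl_relators \<Longrightarrow> free_op r u = 0"
  by (induction rule: two_sided_ideal.induct)
    (simp_all add: free_op_zero free_op_add free_op_mult free_op_relator free_op_right_zero)

end

text \<open>
  Coefficientwise multiplication and differentiation on power series in the variables \<open>'n\<close>; this
  shows that the relations do not collapse the algebra.
\<close>

lemma weyl_operators_power_series:
  "weyl_operators (\<lambda>(c::'k::field) (p::('n \<Rightarrow> nat) \<Rightarrow> 'k) \<alpha>. c * p \<alpha>)
     (\<lambda>i p \<alpha>. if \<alpha> i = 0 then 0 else p (\<alpha>(i := \<alpha> i - 1)))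
     (\<lambda>i p \<alpha>. of_nat (Suc (\<alpha> i)) * p (\<alpha>(i := Suc (\<alpha> i))))"
proof (unfold_locales, goal_cases)
  case (9 i j u)
  show ?case
    by (cases "i = j") (auto simp: fun_eq_iff fun_upd_twist)
next
  case (10 i j u)
  show ?case
    by (cases "i = j") (auto simp: fun_eq_iff fun_upd_twist mult.left_commute)
next
  have succ_mult: "(1 + a) * b = a * b + b" for a b :: 'k
    by (metis add.commute distrib_right mult_1)
  case (11 i j u)
  show ?case
  proof (cases "i = j")
    case True
    then show ?thesis
      by (auto simp: fun_eq_iff plus_fun_def succ_mult)
  next
    case False
    then show ?thesis
      by (auto simp: fun_eq_iff fun_upd_twist plus_fun_def zero_fun_def)
  qed
qed (auto simp: fun_eq_iff plus_fun_def zero_fun_def distrib_left distrib_right mult.assoc mult.left_commute)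

lemma one_notin_weyl_ideal: "1 \<notin> two_sided_ideal (weyl_relators :: ('n weyl_gen, 'k::field) free_algebra set)"
proof
  interpret weyl_operators "\<lambda>(c::'k) (p::('n \<Rightarrow> nat) \<Rightarrow> 'k) \<alpha>. c * p \<alpha>"
     "\<lambda>i p \<alpha>. if \<alpha> i = 0 then 0 else p (\<alpha>(i := \<alpha> i - 1))"
     "\<lambda>i p \<alpha>. of_nat (Suc (\<alpha> i)) * p (\<alpha>(i := Suc (\<alpha> i)))"
    by (rule weyl_operators_power_series)
  assume "1 \<in> two_sided_ideal (weyl_relators :: ('n weyl_gen, 'k) free_algebra set)"
  from free_op_ideal[OF this, of "\<lambda>_. 1"] have "(\<lambda>_. 1 :: 'k) = (0 :: ('n \<Rightarrow> nat) \<Rightarrow> 'k)"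
    by (simp only: free_op_one)
  then show False
    by (simp add: fun_eq_iff)
qed


section \<open>The Weyl algebra\<close>

definition weyl_cong ::
  "('n weyl_gen, 'k::field) free_algebra \<Rightarrow> ('n weyl_gen, 'k) free_algebra \<Rightarrow> bool"
  where "weyl_cong p q \<longleftrightarrow> p - q \<in> two_sided_ideal weyl_relators"

lemma equivp_weyl_cong: "equivp weyl_cong"
proof (rule equivpI)
  show "reflp weyl_cong"
    by (simp add: reflp_def weyl_cong_def ideal_zero)
  show "symp weyl_cong"
    unfolding symp_def weyl_cong_def using ideal_uminus by fastforce
  show "transp weyl_cong"
    unfolding transp_def weyl_cong_def using ideal_add by fastforce
qed

quotient_type (overloaded) ('n, 'k) weyl = "('n weyl_gen, 'k::field) free_algebra" / weyl_cong
  by (rule equivp_weyl_cong)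

instantiation weyl :: (type, field) ring_1
begin

lift_definition zero_weyl :: "('a, 'b) weyl" is 0 .

lift_definition one_weyl :: "('a, 'b) weyl" is 1 .

lift_definition plus_weyl :: "('a, 'b) weyl \<Rightarrow> ('a, 'b) weyl \<Rightarrow> ('a, 'b) weyl" is "(+)"
  unfolding weyl_cong_def by (simp only: add_diff_add ideal_add)

lift_definition uminus_weyl :: "('a, 'b) weyl \<Rightarrow> ('a, 'b) weyl" is uminus
  unfolding weyl_cong_def by (simp only: minus_diff_minus ideal_uminus)

lift_definition minus_weyl :: "('a, 'b) weyl \<Rightarrow> ('a, 'b) weyl \<Rightarrow> ('a, 'b) weyl" is "(-)"
proof -
  fix p p' q q' :: "('a weyl_gen, 'b) free_algebra"
  assume "weyl_cong p p'" "weyl_cong q q'"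
  then have "(p - p') - (q - q') \<in> two_sided_ideal weyl_relators"
    unfolding weyl_cong_def by (rule ideal_diff)
  also have "(p - p') - (q - q') = p - q - (p' - q')"
    by (simp add: algebra_simps)
  finally show "weyl_cong (p - q) (p' - q')"
    unfolding weyl_cong_def .
qed

lift_definition times_weyl :: "('a, 'b) weyl \<Rightarrow> ('a, 'b) weyl \<Rightarrow> ('a, 'b) weyl" is "(*)"
proof -
  fix p p' q q' :: "('a weyl_gen, 'b) free_algebra"
  assume "weyl_cong p p'" "weyl_cong q q'"
  moreover have "p * q - p' * q' = (p - p') * q + p' * (q - q')"
    by (simp add: algebra_simps)
  ultimately show "weyl_cong (p * q) (p' * q')"
    by (simp add: weyl_cong_def ideal_add ideal_mult_left ideal_mult_right)
qed

instance
proof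
  show "(0 :: ('a, 'b) weyl) \<noteq> 1"
    by transfer (use ideal_uminus[of "- 1"] one_notin_weyl_ideal in \<open>auto simp: weyl_cong_def\<close>)
qed (transfer, simp add: weyl_cong_def algebra_simps ideal_zero)+

end

text \<open>The multiplication of the algebra by scalars of the ground field.\<close>

lift_definition weyl_scale :: "'k::field \<Rightarrow> ('n, 'k) weyl \<Rightarrow> ('n, 'k) weyl"
  is "\<lambda>c p. free_const c * p"
  unfolding weyl_cong_def by (metis ideal_mult_left right_diff_distrib)

lift_definition weyl_var :: "'n \<Rightarrow> ('n, 'k::field) weyl" is "\<lambda>i. free_gen (Var i)" .

lift_definition weyl_der :: "'n \<Rightarrow> ('n, 'k::field) weyl" is "\<lambda>i. free_gen (Der i)" .

lemma weyl_relations: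
  "weyl_var i * weyl_var j = (weyl_var j * weyl_var i :: ('n, 'k::field) weyl)"
  "weyl_der i * weyl_der j = (weyl_der j * weyl_der i :: ('n, 'k::field) weyl)"
  "weyl_der i * weyl_var j = (weyl_var j * weyl_der i + (if i = j then 1 else 0) :: ('n, 'k::field) weyl)"
proof -
  have *: "r \<in> two_sided_ideal weyl_relators" if "r \<in> weyl_relators"
    for r :: "('n weyl_gen, 'k) free_algebra"
    using ideal_gen[OF that, of 1 1] by simp
  show "weyl_var i * weyl_var j = (weyl_var j * weyl_var i :: ('n, 'k) weyl)"
  proof transfer
    fix i j :: 'n
    have "free_gen (Var i) * free_gen (Var j) - free_gen (Var j) * free_gen (Var i)
        \<in> (weyl_relators :: ('n weyl_gen, 'k) free_algebra set)"
      unfolding weyl_relators_def by blast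
    from *[OF this]
    show "weyl_cong (free_gen (Var i) * free_gen (Var j))
        (free_gen (Var j) * free_gen (Var i) :: ('n weyl_gen, 'k) free_algebra)"
      unfolding weyl_cong_def .
  qed
  show "weyl_der i * weyl_der j = (weyl_der j * weyl_der i :: ('n, 'k) weyl)"
  proof transfer
    fix i j :: 'n
    have "free_gen (Der i) * free_gen (Der j) - free_gen (Der j) * free_gen (Der i)
        \<in> (weyl_relators :: ('n weyl_gen, 'k) free_algebra set)"
      unfolding weyl_relators_def by blast
    from *[OF this]
    show "weyl_cong (free_gen (Der i) * free_gen (Der j))
        (free_gen (Der j) * free_gen (Der i) :: ('n weyl_gen, 'k) free_algebra)"
      unfolding weyl_cong_def .
  qed
  show "weyl_der i * weyl_var j = (weyl_var j * weyl_der i + (if i = j then 1 else 0) :: ('n, 'k) weyl)"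
  proof transfer
    fix i j :: 'n
    have "free_gen (Der i) * free_gen (Var j) - free_gen (Var j) * free_gen (Der i)
        - (if i = j then 1 else 0) \<in> (weyl_relators :: ('n weyl_gen, 'k) free_algebra set)"
      unfolding weyl_relators_def by blast
    from *[OF this]
    show "weyl_cong (free_gen (Der i) * free_gen (Var j))
        (free_gen (Var j) * free_gen (Der i) + (if i = j then 1 else 0) :: ('n weyl_gen, 'k) free_algebra)"
      unfolding weyl_cong_def by (simp only: diff_diff_eq)
  qed
qed

lemma weyl_induct [case_names scalar var der add mult]:
  fixes a :: "('n, 'k::field) weyl"
  assumes scalar: "\<And>c. P (weyl_scale c 1)"
    and var: "\<And>i. P (weyl_var i)"
    and der: "\<And>i. P (weyl_der i)"
    and add: "\<And>a b. P a \<Longrightarrow> P b \<Longrightarrow> P (a + b)"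
    and mult: "\<And>a b. P a \<Longrightarrow> P b \<Longrightarrow> P (a * b)"
  shows "P a"
proof -
  have "P (abs_weyl p)" for p :: "('n weyl_gen, 'k) free_algebra"
  proof (induction p rule: free_algebra_induct)
    case (add p q)
    then show ?case
      using assms(4) by (simp add: plus_weyl.abs_eq[symmetric])
  next
    case (single w c)
    have "P (abs_weyl (Poly_Mapping.single (Free_Monoid gs) c))" for gs
    proof (induction gs rule: rev_induct)
      case Nil
      have "abs_weyl (Poly_Mapping.single (Free_Monoid []) c) = weyl_scale c (1 :: ('n, 'k) weyl)"
        by (simp add: weyl_scale.abs_eq one_weyl_def free_const_def zero_free_monoid_def)
      then show ?case using scalar by simp
    next
      case (snoc g gs)
      have "Poly_Mapping.single (Free_Monoid (gs @ [g])) c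
          = Poly_Mapping.single (Free_Monoid gs) c * free_gen g"
        by (simp add: free_gen_def mult_single plus_free_monoid_def)
      moreover have "P (abs_weyl (free_gen g))"
        by (cases g) (use var der in \<open>simp_all add: weyl_var_def weyl_der_def\<close>)
      ultimately show ?case
        using mult snoc by (simp add: times_weyl.abs_eq[symmetric])
    qed
    then show ?case by (cases w) simp
  qed
  then show ?thesis
    using Quotient_abs_rep[OF Quotient_weyl, of a] by metis
qed


section \<open>Modules and bimodules\<close>

locale left_module =
  fixes act :: "'r::ring_1 \<Rightarrow> 'm::ab_group_add \<Rightarrow> 'm"
  assumes act_add_left: "act (a + b) u = act a u + act b u"
    and act_add_right: "act a (u + v) = act a u + act a v"
    and act_mult: "act (a * b) u = act a (act b u)"
    and act_one: "act 1 u = u"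

locale right_module =
  fixes act :: "'m::ab_group_add \<Rightarrow> 'r::ring_1 \<Rightarrow> 'm"
  assumes act_add_left: "act (u + v) a = act u a + act v a"
    and act_add_right: "act u (a + b) = act u a + act u b"
    and act_mult: "act u (a * b) = act (act u a) b"
    and act_one: "act u 1 = u"

locale algebra_over_field = vector_space scale
  for scale :: "'k::field \<Rightarrow> 'a::ring_1 \<Rightarrow> 'a" +
  assumes scale_mult_left: "scale c a * b = scale c (a * b)"
    and scale_mult_right: "a * scale c b = scale c (a * b)"

definition algebra_endomorphism :: "('k::field \<Rightarrow> 'a::ring_1 \<Rightarrow> 'a) \<Rightarrow> ('a \<Rightarrow> 'a) \<Rightarrow> bool" where
  "algebra_endomorphism scale f \<longleftrightarrow>
     algebra_over_field scale \<and> Vector_Spaces.linear scale scale f \<and>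
     (\<forall>a b. f (a * b) = f a * f b) \<and> f 1 = 1"

locale bimodule =
  alg: algebra_over_field scaleA + vs: vector_space scaleM +
  left: left_module lact + right: right_module ract
  for scaleA :: "'k::field \<Rightarrow> 'a::ring_1 \<Rightarrow> 'a"
    and scaleM :: "'k \<Rightarrow> 'm::ab_group_add \<Rightarrow> 'm"
    and lact :: "'a \<Rightarrow> 'm \<Rightarrow> 'm"
    and ract :: "'m \<Rightarrow> 'a \<Rightarrow> 'm" +
  assumes lact_scale: "lact (scaleA c a) u = scaleM c (lact a u)"
    and ract_scale: "ract u (scaleA c a) = scaleM c (ract u a)"
    and lact_ract: "ract (lact a u) b = lact a (ract u b)"

lemma algebra_over_field_weyl: "algebra_over_field (weyl_scale :: 'k::field \<Rightarrow> ('n, 'k) weyl \<Rightarrow> _)"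
proof -
  have comm: "p * free_const c = free_const c * p" for p :: "('n weyl_gen, 'k) free_algebra" and c
    by (induction p rule: free_algebra_induct)
      (simp_all add: free_const_def mult_single distrib_left distrib_right mult.commute)
  have const: "free_const (c + d) = (free_const c + free_const d :: ('n weyl_gen, 'k) free_algebra)"
    "free_const (c * d) = (free_const c * free_const d :: ('n weyl_gen, 'k) free_algebra)"
    "free_const 1 = (1 :: ('n weyl_gen, 'k) free_algebra)" for c d
    by (simp_all add: free_const_def single_add mult_single)
  have refl: "p = q \<Longrightarrow> weyl_cong p q" for p q :: "('n weyl_gen, 'k) free_algebra"
    by (simp add: weyl_cong_def ideal_zero)
  show ?thesis
  proof
    fix c d :: 'k and a b :: "('n, 'k) weyl"
    show "weyl_scale c (a + b) = weyl_scale c a + weyl_scale c b"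
      by transfer (simp add: refl distrib_left)
    show "weyl_scale (c + d) a = weyl_scale c a + weyl_scale d a"
      by transfer (simp add: refl const distrib_right)
    show "weyl_scale c (weyl_scale d a) = weyl_scale (c * d) a"
      by transfer (simp add: refl const mult.assoc)
    show "weyl_scale 1 a = a"
      by transfer (simp add: refl const)
    show "weyl_scale c a * b = weyl_scale c (a * b)"
      by transfer (simp add: refl mult.assoc)
    show "a * weyl_scale c b = weyl_scale c (a * b)"
      by transfer (simp add: refl comm mult.assoc[symmetric])
  qed
qed

definition sub_bimodule ::
  "('k::field \<Rightarrow> 'm::ab_group_add \<Rightarrow> 'm) \<Rightarrow> ('a::ring_1 \<Rightarrow> 'm \<Rightarrow> 'm) \<Rightarrow> ('m \<Rightarrow> 'a \<Rightarrow> 'm) \<Rightarrow> 'm set \<Rightarrow> bool"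
  where
  "sub_bimodule scaleM lact ract S \<longleftrightarrow>
     module.subspace scaleM S \<and> (\<forall>a. \<forall>u\<in>S. lact a u \<in> S \<and> ract u a \<in> S)"

definition simple_bimodule ::
  "('k::field \<Rightarrow> 'a::ring_1 \<Rightarrow> 'a) \<Rightarrow> ('k \<Rightarrow> 'm::ab_group_add \<Rightarrow> 'm) \<Rightarrow>
   ('a \<Rightarrow> 'm \<Rightarrow> 'm) \<Rightarrow> ('m \<Rightarrow> 'a \<Rightarrow> 'm) \<Rightarrow> bool"
  where
  "simple_bimodule scaleA scaleM lact ract \<longleftrightarrow>
     bimodule scaleA scaleM lact ract \<and> (UNIV :: 'm set) \<noteq> {0} \<and>
     (\<forall>S. sub_bimodule scaleM lact ract S \<longrightarrow> S = {0} \<or> S = UNIV)"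


section \<open>The Bernstein filtration and holonomic modules\<close>

text \<open>
  \<open>x\<^sup>\<alpha> \<partial>\<^sup>\<beta>\<close>. The products over all indices are taken with \<^const>\<open>Finite_Set.fold\<close>, because the
  library's \<^const>\<open>prod\<close> requires a commutative ring; the factors commute, so the order is immaterial.
\<close>

definition weyl_monomial :: "('n::finite \<Rightarrow> nat) \<Rightarrow> ('n \<Rightarrow> nat) \<Rightarrow> ('n, 'k::field) weyl" where
  "weyl_monomial \<alpha> \<beta> =
     Finite_Set.fold (\<lambda>i a. weyl_var i ^ \<alpha> i * a) 1 UNIV *
     Finite_Set.fold (\<lambda>i a. weyl_der i ^ \<beta> i * a) 1 UNIV"

lemma comp_fun_commute_weyl_powers:
  "comp_fun_commute (\<lambda>i a. weyl_var i ^ \<alpha> i * a :: ('n, 'k::field) weyl)"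
  "comp_fun_commute (\<lambda>i a. weyl_der i ^ \<beta> i * a :: ('n, 'k::field) weyl)"
proof -
  have comm: "x ^ p * y ^ q = y ^ q * x ^ p" if "x * y = y * x" for x y :: "('n, 'k) weyl" and p q
    using power_commuting_commutes[OF power_commuting_commutes[OF that, symmetric], symmetric] .
  show "comp_fun_commute (\<lambda>i a. weyl_var i ^ \<alpha> i * a :: ('n, 'k) weyl)"
    by standard (simp add: fun_eq_iff mult.assoc[symmetric] comm[OF weyl_relations(1)])
  show "comp_fun_commute (\<lambda>i a. weyl_der i ^ \<beta> i * a :: ('n, 'k) weyl)"
    by standard (simp add: fun_eq_iff mult.assoc[symmetric] comm[OF weyl_relations(2)])
qed

definition bernstein :: "nat \<Rightarrow> ('n::finite, 'k::field) weyl set" where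
  "bernstein m =
     module.span weyl_scale {weyl_monomial \<alpha> \<beta> | \<alpha> \<beta>. sum \<alpha> UNIV + sum \<beta> UNIV \<le> m}"

definition finite_generating_set :: "('r::ring_1 \<Rightarrow> 'm::ab_group_add \<Rightarrow> 'm) \<Rightarrow> 'm set \<Rightarrow> bool" where
  "finite_generating_set act G \<longleftrightarrow> finite G \<and> (\<forall>u. \<exists>a. u = (\<Sum>g\<in>G. act (a g) g))"

definition module_filtration ::
  "(('n::finite, 'k::field) weyl \<Rightarrow> 'm::ab_group_add \<Rightarrow> 'm) \<Rightarrow> 'm set \<Rightarrow> nat \<Rightarrow> 'm set" where
  "module_filtration act G i = {\<Sum>g\<in>G. act (b g) g | b. \<forall>g\<in>G. b g \<in> bernstein i}"

text \<open>A module over the Weyl algebra is a vector space over \<open>k\<close> through the scalars \<open>k \<cdot> 1\<close>.\<close>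

definition hilbert_polynomial ::
  "(('n::finite, 'k::field_char_0) weyl \<Rightarrow> 'm::ab_group_add \<Rightarrow> 'm) \<Rightarrow> 'm set \<Rightarrow> rat poly \<Rightarrow> bool"
  where
  "hilbert_polynomial act G p \<longleftrightarrow>
     (\<forall>\<^sub>F i in sequentially.
        of_nat (vector_space.dim (\<lambda>c. act (weyl_scale c 1)) (module_filtration act G i))
          = poly p (of_nat i))"

text \<open>Well defined for finitely generated \<open>M \<noteq> 0\<close>, and meaningful only then.\<close>

definition weyl_module_dim ::
  "(('n::finite, 'k::field_char_0) weyl \<Rightarrow> 'm::ab_group_add \<Rightarrow> 'm) \<Rightarrow> nat" where
  "weyl_module_dim act =
     (THE d. \<exists>G p. finite_generating_set act G \<and> hilbert_polynomial act G p \<and> degree p = d)"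

definition holonomic ::
  "(('n::finite, 'k::field_char_0) weyl \<Rightarrow> 'm::ab_group_add \<Rightarrow> 'm) \<Rightarrow> bool" where
  "holonomic act \<longleftrightarrow>
     left_module act \<and> (\<exists>G. finite_generating_set act G) \<and>
     ((UNIV :: 'm set) = {0} \<or> weyl_module_dim act = card (UNIV :: 'n set))"


section \<open>Bimodules as modules over the Weyl algebra in twice as many variables\<close>

text \<open>
  The index type \<^typ>\<open>'n + 'n\<close> stands for \<open>{1, \<dots>, 2n}\<close>, with \<^term>\<open>Inl i\<close> for \<open>i\<close> and \<^term>\<open>Inr i\<close>
  for \<open>n + i\<close>.
\<close>

definition is_bimodule_action ::
  "('k::field \<Rightarrow> 'm::ab_group_add \<Rightarrow> 'm) \<Rightarrow> (('n, 'k) weyl \<Rightarrow> 'm \<Rightarrow> 'm) \<Rightarrow>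
   ('m \<Rightarrow> ('n, 'k) weyl \<Rightarrow> 'm) \<Rightarrow> (('n + 'n, 'k) weyl \<Rightarrow> 'm \<Rightarrow> 'm) \<Rightarrow> bool"
  where
  "is_bimodule_action scaleM lact ract act \<longleftrightarrow>
     left_module act \<and>
     (\<forall>c u. act (weyl_scale c 1) u = scaleM c u) \<and>
     (\<forall>i u. act (weyl_var (Inl i)) u = lact (weyl_var i) u \<and>
            act (weyl_der (Inl i)) u = lact (weyl_der i) u \<and>
            act (weyl_var (Inr i)) u = ract u (weyl_var i) \<and>
            act (weyl_der (Inr i)) u = - ract u (weyl_der i))"

lemma (in weyl_operators) ex_left_module:
  "\<exists>act. left_module act \<and> (\<forall>c u. act (weyl_scale c 1) u = scale c u) \<and>
     (\<forall>i u. act (weyl_var i) u = X i u \<and> act (weyl_der i) u = D i u)"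
proof -
  define act where "act = (\<lambda>a. free_op (rep_weyl a))"
  have cong: "free_op p u = free_op q u" if "weyl_cong p q" for p q u
    using free_op_ideal[of "p - q" u] that by (simp add: weyl_cong_def free_op_diff)
  have act_abs: "act (abs_weyl p) u = free_op p u" for p u
    unfolding act_def
    by (rule cong) (simp add: weyl.abs_eq_iff[symmetric] Quotient_abs_rep[OF Quotient_weyl])
  have ex_abs: "\<exists>p. a = abs_weyl p" for a :: "('n, 'k) weyl"
    using Quotient_abs_rep[OF Quotient_weyl, of a] by metis
  have "left_module act"
  proof
    fix a b :: "('n, 'k) weyl" and u v
    obtain p q where "a = abs_weyl p" "b = abs_weyl q"
      using ex_abs[of a] ex_abs[of b] by blast
    then show "act (a + b) u = act a u + act b u" "act a (u + v) = act a u + act a v"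
      "act (a * b) u = act a (act b u)"
      by (simp_all add: plus_weyl.abs_eq times_weyl.abs_eq act_abs free_op_add free_op_right_add
          free_op_mult)
    show "act 1 u = u"
      by (simp add: one_weyl_def act_abs free_op_one)
  qed
  moreover have "act (weyl_scale c 1) u = scale c u" for c u
    by (simp add: one_weyl_def weyl_scale.abs_eq act_abs free_op_const)
  moreover have "act (weyl_var i) u = X i u" "act (weyl_der i) u = D i u" for i u
    by (simp_all add: weyl_var_def weyl_der_def act_abs free_op_gen gen_op_def)
  ultimately show ?thesis by blast
qed

lemma (in right_module) act_zero_diff:
  "act u 0 = 0" "act 0 a = 0" "act u (a - b) = act u a - act u b" "act (- u) a = - act u a"
proof -
  show 0: "act u 0 = 0" "act 0 a = 0"
    using act_add_right[of u 0 0] act_add_left[of 0 0 a] by simp_all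
  show "act u (a - b) = act u a - act u b"
    using act_add_right[of u "a - b" b] by simp
  show "act (- u) a = - act u a"
    using act_add_left[of u "- u" a] by (simp add: 0 eq_neg_iff_add_eq_0 add.commute)
qed

lemma ex1_bimodule_action:
  assumes "bimodule weyl_scale scaleM lact ract"
  shows "\<exists>!act. is_bimodule_action scaleM lact ract act"
proof -
  interpret bimodule weyl_scale scaleM lact ract by fact
  have scaleM_left: "scaleM c u = lact (weyl_scale c 1) u" for c u
    by (simp add: lact_scale left.act_one)
  have scaleM_right: "scaleM c u = ract u (weyl_scale c 1)" for c u
    by (simp add: ract_scale right.act_one)
  have lact_scaleM: "lact a (scaleM c u) = scaleM c (lact a u)" for a c u
    unfolding scaleM_left
    by (simp add: left.act_mult[symmetric] alg.scale_mult_left alg.scale_mult_right)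
  have ract_scaleM: "ract (scaleM c u) a = scaleM c (ract u a)" for a c u
    unfolding scaleM_right
    by (simp add: right.act_mult[symmetric] alg.scale_mult_left alg.scale_mult_right)
  have lact_swap: "lact a (lact b u) = lact b (lact a u)" if "a * b = b * a" for a b u
    by (metis left.act_mult that)
  have ract_swap: "ract (ract u a) b = ract (ract u b) a" if "a * b = b * a" for a b u
    by (metis right.act_mult that)
  have lact_0: "lact 0 u = 0" "lact a 0 = 0" for a u
    using left.act_add_left[of 0 0 u] left.act_add_right[of a 0 0] by simp_all
  have lact_minus: "lact a (- u) = - lact a u" for a u
    using left.act_add_right[of a u "- u"] by (simp add: lact_0 eq_neg_iff_add_eq_0 add.commute)
  have lact_DX: "lact (weyl_der i) (lact (weyl_var j) u)
      = lact (weyl_var j) (lact (weyl_der i) u) + (if i = j then u else 0)" for i j u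
    by (simp add: left.act_mult[symmetric] weyl_relations(3) left.act_add_left left.act_one lact_0)
  have ract_DX: "ract (ract u (weyl_der i)) (weyl_var j)
      = ract (ract u (weyl_var j)) (weyl_der i) + (if i = j then u else 0)" for i j u
    by (simp add: right.act_mult[symmetric] weyl_relations(3) right.act_add_right right.act_one
        right.act_zero_diff)
  define X where "X = (\<lambda>s u. case s of Inl i \<Rightarrow> lact (weyl_var i) u | Inr i \<Rightarrow> ract u (weyl_var i))"
  define D where "D = (\<lambda>s u. case s of Inl i \<Rightarrow> lact (weyl_der i) u | Inr i \<Rightarrow> - ract u (weyl_der i))"
  interpret ops: weyl_operators scaleM X D
  proof (unfold_locales, goal_cases)
    case (5 s t u)
    show ?case
      by (cases s; cases t)
        (auto simp: X_def left.act_add_right lact_ract weyl_relations(1)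
          intro: lact_swap ract_swap)
  next
    case (6 s t u)
    show ?case
      by (cases s; cases t)
        (auto simp: D_def right.act_zero_diff lact_minus lact_ract weyl_relations(2)
          intro: lact_swap ract_swap)
  next
    case (7 s t u)
    show ?case
      by (cases s; cases t)
        (auto simp: X_def D_def right.act_zero_diff lact_minus lact_ract lact_DX ract_DX)
  qed (auto simp: X_def D_def left.act_add_right right.act_add_left lact_scaleM ract_scaleM
      split: sum.splits)
  have "\<exists>act. is_bimodule_action scaleM lact ract act"
  proof -
    obtain act where "left_module act" "\<And>c u. act (weyl_scale c 1) u = scaleM c u"
      "\<And>s u. act (weyl_var s) u = X s u" "\<And>s u. act (weyl_der s) u = D s u"
      using ops.ex_left_module by blast
    then have "is_bimodule_action scaleM lact ract act"
      by (simp add: is_bimodule_action_def X_def D_def)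
    then show ?thesis by blast
  qed
  moreover have "act = act'"
    if "is_bimodule_action scaleM lact ract act" "is_bimodule_action scaleM lact ract act'" for act act'
  proof -
    interpret act: left_module act using that by (simp add: is_bimodule_action_def)
    interpret act': left_module act' using that by (simp add: is_bimodule_action_def)
    have "act a u = act' a u" for a u
    proof (induction a arbitrary: u rule: weyl_induct)
      case (var s)
      then show ?case using that by (cases s) (simp_all add: is_bimodule_action_def)
    next
      case (der s)
      then show ?case using that by (cases s) (simp_all add: is_bimodule_action_def)
    qed (use that in \<open>simp_all add: is_bimodule_action_def act.act_add_left act'.act_add_left
        act.act_mult act'.act_mult\<close>)
    then show ?thesis by (simp add: fun_eq_iff)
  qed
  ultimately show ?thesis by blast
qed

definition bimodule_action ::
  "('k::field \<Rightarrow> 'm::ab_group_add \<Rightarrow> 'm) \<Rightarrow> (('n, 'k) weyl \<Rightarrow> 'm \<Rightarrow> 'm) \<Rightarrow>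
   ('m \<Rightarrow> ('n, 'k) weyl \<Rightarrow> 'm) \<Rightarrow> (('n + 'n, 'k) weyl \<Rightarrow> 'm \<Rightarrow> 'm)"
  where "bimodule_action scaleM lact ract = (THE act. is_bimodule_action scaleM lact ract act)"

definition holonomic_bimodule ::
  "('k::field_char_0 \<Rightarrow> 'm::ab_group_add \<Rightarrow> 'm) \<Rightarrow> (('n::finite, 'k) weyl \<Rightarrow> 'm \<Rightarrow> 'm) \<Rightarrow>
   ('m \<Rightarrow> ('n, 'k) weyl \<Rightarrow> 'm) \<Rightarrow> bool"
  where
  "holonomic_bimodule scaleM lact ract \<longleftrightarrow>
     bimodule weyl_scale scaleM lact ract \<and> holonomic (bimodule_action scaleM lact ract)"

end

theory Submission
  imports Defs "HOL-Library.FuncSet" "HOL-Library.Cardinality"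
begin

text \<open>
  Simplicity. Let \<open>S \<noteq> A\<close> be a subbimodule of \<open>A\<^sup>f\<close>, that is, a left ideal with \<open>S f(A) \<subseteq> S\<close>. Then
  \<open>f\<^sup>-\<^sup>1(S)\<close> is a two-sided ideal of the simple algebra \<open>A\<close> not containing \<open>1\<close>, so it is zero and \<open>f\<close>
  induces an injection \<open>A \<rightarrow> A / S\<close>. It maps \<open>B\<^sub>m\<close> into the image of \<open>B\<^bsub>cm\<^esub>\<close> for a constant \<open>c\<close>. If \<open>S\<close>
  were not zero, the dimension of that image would be \<open>O(m\<^bsup>2n-1\<^esup>)\<close>, because the leading exponents of
  elements of \<open>S\<close> form a nonempty up-closed set; but \<open>dim B\<^sub>m\<close> grows like \<open>m\<^bsup>2n\<^esup>\<close>.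
  The dual graph is treated in the same way, with right ideals.

  Holonomicity. The filtration of \<open>A\<^sup>f\<close> generated by \<open>1\<close> over \<open>A\<^bsub>2n\<^esub>\<close> lies between \<open>B\<^sub>m\<close> and \<open>B\<^bsub>cm\<^esub>\<close>, and
  other finite generating sets change it by a bounded shift only, so every Hilbert polynomial has
  degree \<open>2n\<close>. One exists because the dimensions count the standard exponents (those that are not
  leading exponents of annihilators of \<open>1\<close>), which form a down-closed set.
\<close>

section \<open>Exponents\<close>

definition exps :: "nat \<Rightarrow> ('g::finite \<Rightarrow> nat) set" where
  "exps d = {\<mu>. sum \<mu> UNIV \<le> d}"

lemma card_funs: "card {\<mu> :: 'g::finite \<Rightarrow> nat. \<forall>g. \<mu> g \<in> T g} = (\<Prod>g\<in>UNIV. card (T g))"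
proof -
  have "{\<mu> :: 'g \<Rightarrow> nat. \<forall>g. \<mu> g \<in> T g} = PiE UNIV T"
    by (auto simp: PiE_def Pi_def)
  then show ?thesis by (simp add: card_PiE)
qed

lemma finite_funs:
  assumes "\<And>g. finite (T g)"
  shows "finite {\<mu> :: 'g::finite \<Rightarrow> nat. \<forall>g. \<mu> g \<in> T g}"
proof -
  have "{\<mu> :: 'g \<Rightarrow> nat. \<forall>g. \<mu> g \<in> T g} = PiE UNIV T"
    by (auto simp: PiE_def Pi_def)
  then show ?thesis by (simp add: finite_PiE assms)
qed

lemma exps_subset_box: "exps d \<subseteq> {\<mu> :: 'g::finite \<Rightarrow> nat. \<forall>g. \<mu> g \<in> {..d}}"
proof -
  have "\<mu> g \<le> sum \<mu> UNIV" for \<mu> :: "'g \<Rightarrow> nat" and g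
    by (rule member_le_sum) auto
  then show ?thesis by (auto simp: exps_def intro: order_trans)
qed

lemma finite_exps: "finite (exps d :: ('g::finite \<Rightarrow> nat) set)"
  by (rule finite_subset[OF exps_subset_box]) (rule finite_funs, simp)

lemma card_exps_upper: "card (exps d :: ('g::finite \<Rightarrow> nat) set) \<le> Suc d ^ CARD('g)"
proof -
  have "card (exps d :: ('g \<Rightarrow> nat) set) \<le> card {\<mu> :: 'g \<Rightarrow> nat. \<forall>g. \<mu> g \<in> {..d}}"
    by (intro card_mono finite_funs exps_subset_box) auto
  then show ?thesis by (simp only: card_funs) simp
qed

lemma card_exps_lower: "Suc m ^ CARD('g) \<le> card (exps (CARD('g) * m) :: ('g::finite \<Rightarrow> nat) set)"
proof -
  \<comment> \<open>The cube of side \<open>m\<close> lies in the simplex of degree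
    \<open>CARD('g) * m\<close>; this crude inclusion already has the right order of growth.\<close>
  have "{\<mu> :: 'g \<Rightarrow> nat. \<forall>g. \<mu> g \<in> {..m}} \<subseteq> exps (CARD('g) * m)"
    using sum_bounded_above[of UNIV _ m] by (auto simp: exps_def)
  from card_mono[OF finite_exps this] show ?thesis by (simp only: card_funs) simp
qed

text \<open>An exponent not above \<open>\<mu>0\<close> falls short in some coordinate
  \<open>h\<close>. That coordinate takes at most \<open>\<mu>0 h\<close> values and the others at
  most \<open>d + 1\<close>, so one power of \<open>d\<close> is lost.\<close>

lemma card_exps_not_ge:
  fixes \<mu>0 :: "'g::finite \<Rightarrow> nat"
  shows "card {\<mu> \<in> exps d. \<not> \<mu>0 \<le> \<mu>} \<le> sum \<mu>0 UNIV * Suc d ^ (CARD('g) - 1)"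
proof -
  define T where "T = (\<lambda>h g. if g = h then {..<\<mu>0 h} else {..d})"
  have sub: "{\<mu> \<in> exps d. \<not> \<mu>0 \<le> \<mu>} \<subseteq> (\<Union>h. {\<mu>. \<forall>g. \<mu> g \<in> T h g})"
    using exps_subset_box[where 'g = 'g] by (fastforce simp: T_def le_fun_def not_le)
  have fin: "finite {\<mu>. \<forall>g. \<mu> g \<in> T h g}" for h
    by (rule finite_funs) (simp add: T_def)
  have "card {\<mu>. \<forall>g. \<mu> g \<in> T h g} = \<mu>0 h * Suc d ^ (CARD('g) - 1)" for h
  proof -
    have "(\<Prod>g\<in>UNIV. card (T h g)) = card (T h h) * (\<Prod>g\<in>UNIV - {h}. card (T h g))"
      by (simp add: prod.remove)
    also have "(\<Prod>g\<in>UNIV - {h}. card (T h g)) = (\<Prod>g\<in>UNIV - {h}. Suc d)"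
      by (rule prod.cong) (auto simp: T_def)
    finally show ?thesis by (simp add: card_funs T_def card_Diff_singleton)
  qed
  then have "card (\<Union>h. {\<mu>. \<forall>g. \<mu> g \<in> T h g}) \<le> (\<Sum>h\<in>UNIV. \<mu>0 h * Suc d ^ (CARD('g) - 1))"
    using card_UN_le[of "UNIV :: 'g set" "\<lambda>h. {\<mu>. \<forall>g. \<mu> g \<in> T h g}"] by simp
  then show ?thesis
    using card_mono[OF _ sub] fin by (simp add: sum_distrib_right)
qed

abbreviation bump :: "('g \<Rightarrow> nat) \<Rightarrow> 'g \<Rightarrow> 'g \<Rightarrow> nat" where
  "bump \<mu> g \<equiv> \<mu>(g := Suc (\<mu> g))"

lemma sum_bump: "sum (bump \<mu> g) UNIV = Suc (sum \<mu> (UNIV :: 'g::finite set))"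
proof -
  have "sum (bump \<mu> g) (UNIV - {g}) = sum \<mu> (UNIV - {g})"
    by (rule sum.cong) auto
  then show ?thesis
    by (simp add: sum.remove[of UNIV g])
qed

lemma bump_in_exps: "\<mu> \<in> exps d \<Longrightarrow> bump \<mu> g \<in> exps (Suc d)"
  by (simp only: exps_def mem_Collect_eq sum_bump)

lemma exps_mono: "d \<le> e \<Longrightarrow> exps d \<subseteq> exps e"
  by (auto simp: exps_def)

text \<open>A graded monomial order, presented through the position of an exponent in it.\<close>

lemma graded_order_exists:
  obtains r :: "('g::finite \<Rightarrow> nat) \<Rightarrow> nat"
  where "inj r"
    and "\<And>\<mu> \<nu>. sum \<mu> UNIV < sum \<nu> UNIV \<Longrightarrow> r \<mu> < r \<nu>"
    and "\<And>\<mu> \<nu> g. r \<mu> < r \<nu> \<Longrightarrow> r (bump \<mu> g) < r (bump \<nu> g)"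
proof -
  \<comment> \<open>The injection \<open>h\<close> orders the coordinates, which gives lexicographic
    comparison a meaning.\<close>
  obtain h :: "'g \<Rightarrow> nat" where h: "inj h"
    using finite_imp_inj_to_nat_seg[of "UNIV :: 'g set"] by auto
  define lex where "lex = (\<lambda>\<mu> \<nu> :: 'g \<Rightarrow> nat. \<exists>k. \<mu> k < \<nu> k \<and> (\<forall>l. h l < h k \<longrightarrow> \<mu> l = \<nu> l))"
  define less where "less = (\<lambda>\<mu> \<nu> :: 'g \<Rightarrow> nat. sum \<mu> UNIV < sum \<nu> UNIV \<or> sum \<mu> UNIV = sum \<nu> UNIV \<and> lex \<mu> \<nu>)"
  have lex_trans: "lex \<mu> \<rho>" if "lex \<mu> \<nu>" "lex \<nu> \<rho>" for \<mu> \<nu> \<rho>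
  proof -
    from that obtain k l where k: "\<mu> k < \<nu> k" "\<And>i. h i < h k \<Longrightarrow> \<mu> i = \<nu> i"
      and l: "\<nu> l < \<rho> l" "\<And>i. h i < h l \<Longrightarrow> \<nu> i = \<rho> i"
      unfolding lex_def by blast
    consider "h k < h l" | "h l < h k" | "k = l"
      using h by (metis injD linorder_neqE_nat)
    then show ?thesis
    proof cases
      case 1
      then show ?thesis unfolding lex_def using k l by (intro exI[of _ k]) auto
    next
      case 2
      then show ?thesis unfolding lex_def using k l by (intro exI[of _ l]) auto
    next
      case 3
      then show ?thesis unfolding lex_def using k l by (intro exI[of _ k]) auto
    qed
  qed
  have lex_total: "lex \<mu> \<nu> \<or> lex \<nu> \<mu>" if "\<mu> \<noteq> \<nu>" for \<mu> \<nu>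
  proof -
    from that obtain k0 where "\<mu> k0 \<noteq> \<nu> k0" by auto
    from ex_has_least_nat[of "\<lambda>k. \<mu> k \<noteq> \<nu> k", OF this, of h]
    obtain k where "\<mu> k \<noteq> \<nu> k" "\<And>l. \<mu> l \<noteq> \<nu> l \<Longrightarrow> h k \<le> h l" by blast
    then show ?thesis unfolding lex_def by (metis linorder_neqE_nat not_le)
  qed
  have irrefl: "\<not> less \<mu> \<mu>" for \<mu>
    by (simp add: less_def lex_def)
  have trans: "less \<mu> \<rho>" if "less \<mu> \<nu>" "less \<nu> \<rho>" for \<mu> \<nu> \<rho>
    using that lex_trans unfolding less_def by auto
  have total: "less \<mu> \<nu> \<or> less \<nu> \<mu>" if "\<mu> \<noteq> \<nu>" for \<mu> \<nu>
    using lex_total[OF that] unfolding less_def by auto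
  have bump: "less (bump \<mu> g) (bump \<nu> g)" if "less \<mu> \<nu>" for \<mu> \<nu> g
  proof -
    have "lex (bump \<mu> g) (bump \<nu> g)" if "lex \<mu> \<nu>"
    proof -
      from that obtain k where "\<mu> k < \<nu> k" "\<And>l. h l < h k \<Longrightarrow> \<mu> l = \<nu> l"
        unfolding lex_def by blast
      then show ?thesis unfolding lex_def by (intro exI[of _ k]) auto
    qed
    then show ?thesis using that unfolding less_def sum_bump by auto
  qed
  \<comment> \<open>The position of an exponent is the number of its predecessors. It is finite
    because the order is graded and each degree bound admits finitely many exponents.\<close>
  define r where "r = (\<lambda>\<mu>. card {\<nu>. less \<nu> \<mu>})"
  have fin: "finite {\<nu>. less \<nu> \<mu>}" for \<mu>
    by (rule finite_subset[OF _ finite_exps[of "sum \<mu> UNIV"]]) (auto simp: less_def exps_def)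
  have mono: "r \<mu> < r \<nu>" if "less \<mu> \<nu>" for \<mu> \<nu>
    unfolding r_def
    by (rule psubset_card_mono[OF fin]) (use that trans irrefl in blast)
  have iff: "r \<mu> < r \<nu> \<longleftrightarrow> less \<mu> \<nu>" for \<mu> \<nu>
    using mono total by (metis less_asym less_irrefl_nat)
  show thesis
  proof
    show "inj r" by (rule injI) (metis iff total less_irrefl)
    show "r \<mu> < r \<nu>" if "sum \<mu> UNIV < sum \<nu> UNIV" for \<mu> \<nu>
      using that by (simp add: iff less_def)
    show "r (bump \<mu> g) < r (bump \<nu> g)" if "r \<mu> < r \<nu>" for \<mu> \<nu> g
      using that bump by (simp add: iff)
  qed
qed

section \<open>Hilbert functions of sets of exponents\<close>

definition eventually_poly :: "(nat \<Rightarrow> nat) \<Rightarrow> bool" where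
  "eventually_poly h \<longleftrightarrow> (\<exists>p :: rat poly. \<forall>\<^sub>F i in sequentially. of_nat (h i) = poly p (of_nat i))"

lemma eventually_polyI:
  "(\<And>i. i \<ge> N \<Longrightarrow> of_nat (h i) = poly (p :: rat poly) (of_nat i)) \<Longrightarrow> eventually_poly h"
  unfolding eventually_poly_def eventually_sequentially by blast

lemma eventually_polyE:
  assumes "eventually_poly h"
  obtains p :: "rat poly" and N where "\<And>i. i \<ge> N \<Longrightarrow> of_nat (h i) = poly p (of_nat i)"
  using assms unfolding eventually_poly_def eventually_sequentially by blast

lemma eventually_poly_const: "eventually_poly (\<lambda>_. c)"
  by (rule eventually_polyI[of 0 _ "[:of_nat c:]"]) simp

lemma eventually_poly_add:
  assumes "eventually_poly h" "eventually_poly k"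
  shows "eventually_poly (\<lambda>i. h i + k i)"
proof -
  obtain p N where p: "\<And>i. i \<ge> N \<Longrightarrow> of_nat (h i) = poly (p :: rat poly) (of_nat i)"
    using assms(1) by (rule eventually_polyE) blast
  obtain q M where q: "\<And>i. i \<ge> M \<Longrightarrow> of_nat (k i) = poly (q :: rat poly) (of_nat i)"
    using assms(2) by (rule eventually_polyE) blast
  show ?thesis
    by (rule eventually_polyI[of "max N M" _ "p + q"]) (simp add: p q)
qed

lemma eventually_poly_sum:
  "finite J \<Longrightarrow> (\<And>j. j \<in> J \<Longrightarrow> eventually_poly (h j)) \<Longrightarrow> eventually_poly (\<lambda>i. \<Sum>j\<in>J. h j i)"
  by (induction J rule: finite_induct) (auto intro: eventually_poly_const eventually_poly_add)

lemma eventually_poly_shift: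
  assumes "eventually_poly h"
  shows "eventually_poly (\<lambda>i. h (i - j))"
proof -
  obtain p N where p: "\<And>i. i \<ge> N \<Longrightarrow> of_nat (h i) = poly (p :: rat poly) (of_nat i)"
    using assms by (rule eventually_polyE) blast
  \<comment> \<open>From \<open>N + j\<close> on, the natural subtraction \<open>i - j\<close> is
    not cut off and its value is at least \<open>N\<close>.\<close>
  show ?thesis
    by (rule eventually_polyI[of "N + j" _ "pcompose p [:- of_nat j, 1:]"])
      (simp add: p poly_pcompose of_nat_diff)
qed

lemma eventually_poly_cong:
  assumes "eventually_poly h" "\<And>i. i \<ge> N \<Longrightarrow> k i = h i"
  shows "eventually_poly k"
proof -
  obtain p M where p: "\<And>i. i \<ge> M \<Longrightarrow> of_nat (h i) = poly (p :: rat poly) (of_nat i)"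
    using assms(1) by (rule eventually_polyE) blast
  show ?thesis
    by (rule eventually_polyI[of "max N M" _ p]) (simp add: p assms(2))
qed

text \<open>Faulhaber's recursion: telescope \<open>(t + 1) ^ (n + 1) - t ^ (n + 1)\<close>, expand
  binomially and solve for the power sum of exponent \<open>n\<close>. The power sums of smaller
  exponent are polynomial by induction.\<close>

lemma power_sum_poly:
  "\<exists>P :: rat poly. \<forall>m. (\<Sum>t<m. of_nat t ^ n) = poly P (of_nat m)"
proof (induction n rule: less_induct)
  case (less n)
  then obtain P :: "nat \<Rightarrow> rat poly"
    where P: "\<And>k m. k < n \<Longrightarrow> (\<Sum>t<m. of_nat t ^ k) = poly (P k) (of_nat m)"
    by metis
  define Q where "Q = smult (1 / of_nat (Suc n))
    (monom 1 (Suc n) - (\<Sum>k<n. smult (of_nat (Suc n choose k)) (P k)))"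
  have "(\<Sum>t<m. of_nat t ^ n) = poly Q (of_nat m)" for m
  proof -
    have "of_nat m ^ Suc n = (\<Sum>t<m. of_nat (Suc t) ^ Suc n - of_nat t ^ Suc n :: rat)"
      by (subst sum_lessThan_telescope) simp
    also have "\<dots> = (\<Sum>t<m. \<Sum>k\<le>n. of_nat (Suc n choose k) * of_nat t ^ k)"
    proof (rule sum.cong)
      fix t
      have "of_nat (Suc t) ^ Suc n = (of_nat t + 1 :: rat) ^ Suc n"
        by (simp add: add.commute)
      also have "\<dots> = (\<Sum>k\<le>Suc n. of_nat (Suc n choose k) * of_nat t ^ k)"
        by (subst binomial_ring) simp
      finally show "of_nat (Suc t) ^ Suc n - of_nat t ^ Suc n
          = (\<Sum>k\<le>n. of_nat (Suc n choose k) * of_nat t ^ k :: rat)"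
        by simp
    qed simp
    also have "\<dots> = (\<Sum>k\<le>n. of_nat (Suc n choose k) * (\<Sum>t<m. of_nat t ^ k))"
      by (subst sum.swap) (simp add: sum_distrib_left)
    also have "\<dots> = (\<Sum>k<n. of_nat (Suc n choose k) * (\<Sum>t<m. of_nat t ^ k))
        + of_nat (Suc n) * (\<Sum>t<m. of_nat t ^ n)"
      by (simp add: lessThan_Suc_atMost[symmetric] del: of_nat_Suc)
    also have "(\<Sum>k<n. of_nat (Suc n choose k) * (\<Sum>t<m. of_nat t ^ k))
        = (\<Sum>k<n. of_nat (Suc n choose k) * poly (P k) (of_nat m))"
      by (rule sum.cong) (simp_all add: P)
    finally show ?thesis
      by (simp add: Q_def poly_monom poly_sum field_simps del: of_nat_Suc)
  qed
  then show ?case by blast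
qed

lemma poly_sum_poly:
  fixes q :: "rat poly"
  shows "\<exists>P. \<forall>m. (\<Sum>t<m. poly q (of_nat t)) = poly P (of_nat m)"
proof -
  obtain P :: "nat \<Rightarrow> rat poly"
    where P: "\<And>k m. (\<Sum>t<m. of_nat t ^ k) = poly (P k) (of_nat m)"
    using power_sum_poly by metis
  have "(\<Sum>t<m. poly q (of_nat t))
      = poly (\<Sum>k\<le>degree q. smult (coeff q k) (P k)) (of_nat m)" for m
    unfolding poly_altdef[of q]
    by (subst sum.swap) (simp add: poly_sum P[symmetric] sum_distrib_left)
  then show ?thesis by blast
qed

lemma eventually_poly_partial_sums:
  assumes "eventually_poly h"
  shows "eventually_poly (\<lambda>i. \<Sum>t\<le>i. h t)"
proof -
  obtain p N where p: "\<And>i. i \<ge> N \<Longrightarrow> of_nat (h i) = poly (p :: rat poly) (of_nat i)"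
    using assms by (rule eventually_polyE) blast
  obtain P where P: "\<And>m. (\<Sum>t<m. poly p (of_nat t)) = poly P (of_nat m)"
    using poly_sum_poly by metis
  \<comment> \<open>From \<open>N\<close> on, \<open>h\<close> agrees with \<open>p\<close>, so
    replacing \<open>h\<close> by \<open>p\<close> in a partial sum changes it by this
    constant.\<close>
  define c where "c = (\<Sum>t<N. of_nat (h t) - poly p (of_nat t))"
  show ?thesis
  proof (rule eventually_polyI)
    fix i assume "N \<le> i"
    have "(\<Sum>t<Suc i. of_nat (h t)) = (\<Sum>t<Suc i. of_nat (h t) - poly p (of_nat t)) + (\<Sum>t<Suc i. poly p (of_nat t))"
      by (simp add: sum_subtractf del: sum.lessThan_Suc)
    also have "(\<Sum>t<Suc i. of_nat (h t) - poly p (of_nat t)) = c"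
      unfolding c_def using \<open>N \<le> i\<close> p by (intro sum.mono_neutral_right) auto
    also have "(\<Sum>t<Suc i. poly p (of_nat t)) = poly P (of_nat (Suc i))"
      by (rule P)
    finally show "of_nat (\<Sum>t\<le>i. h t) = poly ([:c:] + pcompose P [:1, 1:]) (of_nat i)"
      by (simp add: lessThan_Suc_atMost poly_pcompose)
  qed
qed

section \<open>Dickson's lemma and the Hilbert function of a down-closed set\<close>

lemma nat_subseq_mono:
  fixes s :: "nat \<Rightarrow> nat"
  obtains f :: "nat \<Rightarrow> nat" where "strict_mono f" "incseq (\<lambda>n. s (f n))"
proof -
  obtain f :: "nat \<Rightarrow> nat" where f: "strict_mono f" "monoseq (\<lambda>n. s (f n))"
    using seq_monosub by blast
  show thesis
  proof (cases "incseq (\<lambda>n. s (f n))")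
    case False
    then have dec: "s (f n) \<le> s (f m)" if "m \<le> n" for m n
      using f(2) that by (auto simp: monoseq_iff decseq_def)
    \<comment> \<open>A weakly decreasing sequence of naturals is constant once it attains its least
      value, so its tail is also weakly increasing.\<close>
    obtain N where N: "\<And>n. s (f N) \<le> s (f n)"
      using ex_has_least_nat[of "\<lambda>_. True" 0 "\<lambda>n. s (f n)"] by blast
    have "s (f (N + n)) = s (f N)" for n
      using N dec[of N "N + n"] by (simp add: le_antisym)
    then have "incseq (\<lambda>n. s (f (N + n)))" by (simp add: incseq_def)
    moreover have "strict_mono (\<lambda>n. f (N + n))"
      using f(1) by (simp add: strict_mono_def)
    ultimately show thesis using that by blast
  qed (use f that in blast)
qed

text \<open>Dickson's lemma in sequence form: subsequences are refined one coordinate at a time, and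
  refinement preserves the monotonicity already reached.\<close>

lemma dickson:
  fixes s :: "nat \<Rightarrow> 'i \<Rightarrow> nat"
  assumes "finite F"
  shows "\<exists>f :: nat \<Rightarrow> nat. strict_mono f \<and> (\<forall>i\<in>F. incseq (\<lambda>n. s (f n) i))"
  using assms
proof (induction F rule: finite_induct)
  case empty
  show ?case by (rule exI[of _ id]) (simp add: strict_mono_def)
next
  case (insert a F)
  then obtain f where f: "strict_mono f" "\<And>i. i \<in> F \<Longrightarrow> incseq (\<lambda>n. s (f n) i)" by blast
  obtain g where g: "strict_mono g" "incseq (\<lambda>n. s (f (g n)) a)"
    using nat_subseq_mono[of "\<lambda>n. s (f n) a"] by blast
  have "incseq (\<lambda>n. s (f (g n)) i)" if "i \<in> F" for i
    using f(2)[OF that] strict_mono_mono[OF g(1)] by (simp add: incseq_def mono_def)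
  then show ?case
    using g f(1) by (intro exI[of _ "f \<circ> g"]) (auto simp: strict_mono_def)
qed

definition down_closed :: "('i \<Rightarrow> nat) set \<Rightarrow> bool" where
  "down_closed C \<longleftrightarrow> (\<forall>\<mu>\<in>C. \<forall>\<nu>\<le>\<mu>. \<nu> \<in> C)"

text \<open>If the chain kept shrinking, there would be infinitely many elements, each lost at a
  later stage. By Dickson's lemma an earlier one lies below a later one, which belongs to the stage
  where the earlier one is already missing; this contradicts down-closedness.\<close>

lemma decreasing_down_closed_stabilizes:
  fixes C :: "nat \<Rightarrow> ('i \<Rightarrow> nat) set"
  assumes "finite F"
    and supp: "\<And>j \<mu> i. \<mu> \<in> C j \<Longrightarrow> i \<notin> F \<Longrightarrow> \<mu> i = 0"
    and down: "\<And>j. down_closed (C j)"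
    and dec: "\<And>j k. j \<le> k \<Longrightarrow> C k \<subseteq> C j"
  shows "\<exists>J. \<forall>j\<ge>J. C j = C J"
proof (rule ccontr)
  assume "\<not> (\<exists>J. \<forall>j\<ge>J. C j = C J)"
  then have "\<exists>j>J. \<exists>\<mu>. \<mu> \<in> C J \<and> \<mu> \<notin> C j" for J
    using dec by (metis nless_le subsetI subset_antisym)
  then obtain e \<mu> where e: "\<And>J. e J > J" "\<And>J. \<mu> J \<in> C J" "\<And>J. \<mu> J \<notin> C (e J)"
    by metis
  \<comment> \<open>Iterating \<open>e\<close> spaces the stages so that the element chosen at stage
    \<open>t n\<close> is missing from stage \<open>t (Suc n)\<close>.\<close>
  define t where "t = (\<lambda>n. (e ^^ n) 0)"
  have "t n < t (Suc n)" for n by (simp add: t_def e)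
  then have t_mono: "strict_mono t" by (simp add: strict_mono_Suc_iff)
  obtain f where f: "strict_mono f" "\<And>i. i \<in> F \<Longrightarrow> incseq (\<lambda>n. \<mu> (t (f n)) i)"
    using dickson[OF assms(1), of "\<lambda>n. \<mu> (t n)"] by blast
  have "\<mu> (t (f 0)) i \<le> \<mu> (t (f 1)) i" for i
    using f(2)[of i] supp[OF e(2), of i] by (cases "i \<in> F") (auto simp: incseq_def)
  moreover have "C (t (f 1)) \<subseteq> C (e (t (f 0)))"
  proof (rule dec)
    have "e (t (f 0)) = t (Suc (f 0))" by (simp add: t_def)
    also have "\<dots> \<le> t (f 1)"
      using f(1) t_mono by (simp add: strict_mono_less_eq Suc_le_eq strict_mono_less)
    finally show "e (t (f 0)) \<le> t (f 1)" .
  qed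
  ultimately have "\<mu> (t (f 0)) \<in> C (e (t (f 0)))"
    using e(2)[of "t (f 1)"] down[of "e (t (f 0))"] unfolding down_closed_def le_fun_def by blast
  then show False using e(3) by blast
qed

text \<open>Induction on the number of variables. The slices at fixed values of one variable form a
  decreasing chain of down-closed sets, so they are all equal from some \<open>J\<close> on. The
  finite support set \<open>F\<close> makes it possible to drop a variable without changing the
  type.\<close>

lemma down_closed_hilbert:
  fixes C :: "('i \<Rightarrow> nat) set"
  assumes "finite F" "down_closed C" "\<And>\<mu> i. \<mu> \<in> C \<Longrightarrow> i \<notin> F \<Longrightarrow> \<mu> i = 0"
  shows "(\<forall>d. finite {\<mu>\<in>C. sum \<mu> F \<le> d}) \<and> eventually_poly (\<lambda>d. card {\<mu>\<in>C. sum \<mu> F \<le> d})"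
  using assms
proof (induction F arbitrary: C rule: finite_induct)
  case empty
  then have "C \<subseteq> {\<lambda>_. 0}" by auto
  then have "finite C" by (rule finite_subset) simp
  then show ?case by (auto intro: eventually_poly_const)
next
  case (insert a F)
  \<comment> \<open>The slice at height \<open>j\<close> is stored with its coordinate
    \<open>a\<close> reset to 0, so that it is supported in \<open>F\<close> and slices at different
    heights can be compared.\<close>
  define S where "S = (\<lambda>j. {\<mu>. \<mu> a = 0 \<and> \<mu>(a := j) \<in> C})"
  define H where "H = (\<lambda>j d. {\<mu>\<in>S j. sum \<mu> F \<le> d})"
  have S_supp: "\<mu> i = 0" if "\<mu> \<in> S j" "i \<notin> F" for j \<mu> i
    using that insert.prems(2)[of "\<mu>(a := j)" i] by (cases "i = a") (auto simp: S_def simp del: fun_upd_apply, simp)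
  have S_down: "down_closed (S j)" for j
    unfolding down_closed_def
  proof (intro ballI allI impI)
    fix \<mu> \<nu> assume *: "\<mu> \<in> S j" "\<nu> \<le> \<mu>"
    then have "\<nu>(a := j) \<le> \<mu>(a := j)" by (simp add: le_fun_def)
    moreover have "\<nu> a = 0" using * le_funD[of \<nu> \<mu> a] by (simp add: S_def)
    ultimately show "\<nu> \<in> S j"
      using * insert.prems(1) unfolding S_def down_closed_def by blast
  qed
  have S_dec: "S k \<subseteq> S j" if "j \<le> k" for j k
  proof
    fix \<mu> assume *: "\<mu> \<in> S k"
    have "\<mu>(a := j) \<le> \<mu>(a := k)" using that by (simp add: le_fun_def)
    then show "\<mu> \<in> S j"
      using * insert.prems(1) unfolding S_def down_closed_def by blast
  qed
  have IH: "finite (H j d)" "eventually_poly (\<lambda>d. card (H j d))" for j d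
    unfolding H_def using insert.IH[of "S j"] S_down S_supp by blast+
  obtain J where J: "\<And>j. j \<ge> J \<Longrightarrow> S j = S J"
    using decreasing_down_closed_stabilizes[of F S] insert.hyps(1) S_supp S_down S_dec by metis
  have sum_upd: "sum (\<mu>(a := j)) F = sum \<mu> F" for \<mu> :: "'i \<Rightarrow> nat" and j
    using insert.hyps(2) by (intro sum.cong) auto
  have decomp: "{\<mu>\<in>C. sum \<mu> (insert a F) \<le> d} = (\<Union>j\<le>d. (\<lambda>\<mu>. \<mu>(a := j)) ` H j (d - j))" for d
  proof (intro equalityI subsetI)
    fix \<mu> assume *: "\<mu> \<in> {\<mu>\<in>C. sum \<mu> (insert a F) \<le> d}"
    then have le: "\<mu> a + sum \<mu> F \<le> d" using insert.hyps by simp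
    have "\<mu>(a := 0) \<in> H (\<mu> a) (d - \<mu> a)"
      using * le unfolding H_def S_def mem_Collect_eq sum_upd by simp
    then have "(\<mu>(a := 0))(a := \<mu> a) \<in> (\<lambda>\<nu>. \<nu>(a := \<mu> a)) ` H (\<mu> a) (d - \<mu> a)"
      by (rule imageI)
    then show "\<mu> \<in> (\<Union>j\<le>d. (\<lambda>\<mu>. \<mu>(a := j)) ` H j (d - j))"
      using le by (intro UN_I[of "\<mu> a"]) simp_all
  next
    fix \<mu> assume "\<mu> \<in> (\<Union>j\<le>d. (\<lambda>\<mu>. \<mu>(a := j)) ` H j (d - j))"
    then obtain j \<nu> where "j \<le> d" "\<nu> \<in> H j (d - j)" "\<mu> = \<nu>(a := j)" by blast
    then show "\<mu> \<in> {\<mu>\<in>C. sum \<mu> (insert a F) \<le> d}"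
      using insert.hyps by (auto simp: H_def S_def sum_upd fun_upd_same simp del: fun_upd_apply)
  qed
  have inj: "inj_on (\<lambda>\<mu>. \<mu>(a := j)) (H j d)" for j d
  proof (rule inj_onI)
    fix \<mu> \<nu> assume "\<mu> \<in> H j d" "\<nu> \<in> H j d" "\<mu>(a := j) = \<nu>(a := j)"
    then have "\<mu> a = \<nu> a" "\<And>i. i \<noteq> a \<Longrightarrow> \<mu> i = \<nu> i"
      by (simp_all add: H_def S_def) (metis fun_upd_other)
    then show "\<mu> = \<nu>" by (metis ext)
  qed
  have card: "card {\<mu>\<in>C. sum \<mu> (insert a F) \<le> d} = (\<Sum>j\<le>d. card (H j (d - j)))" for d
    unfolding decomp
  proof (subst card_UN_disjoint)
    show "\<forall>i\<in>{..d}. \<forall>j\<in>{..d}. i \<noteq> j \<longrightarrow>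
        (\<lambda>\<mu>. \<mu>(a := i)) ` H i (d - i) \<inter> (\<lambda>\<mu>. \<mu>(a := j)) ` H j (d - j) = {}"
      by (auto dest: fun_cong[of _ _ a])
  qed (simp_all add: IH card_image inj)
  \<comment> \<open>The first \<open>J\<close> slices contribute finitely many shifted functions.
    The remaining slices are all equal to \<open>S J\<close> and contribute partial sums of a single
    function.\<close>
  have "eventually_poly (\<lambda>d. (\<Sum>j<J. card (H j (d - j))) + (\<Sum>t\<le>d - J. card (H J t)))"
  proof (rule eventually_poly_add)
    show "eventually_poly (\<lambda>d. \<Sum>j<J. card (H j (d - j)))"
      by (rule eventually_poly_sum) (use eventually_poly_shift[OF IH(2)] in simp_all)
    show "eventually_poly (\<lambda>d. \<Sum>t\<le>d - J. card (H J t))"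
      by (rule eventually_poly_shift[OF eventually_poly_partial_sums[OF IH(2)]])
  qed
  then have "eventually_poly (\<lambda>d. card {\<mu>\<in>C. sum \<mu> (insert a F) \<le> d})"
  proof (rule eventually_poly_cong[where N = J])
    fix d assume "J \<le> d"
    then have split: "{..d} = {..<J} \<union> {J..d}" by auto
    have "(\<Sum>j\<le>d. card (H j (d - j))) = (\<Sum>j<J. card (H j (d - j))) + (\<Sum>j=J..d. card (H j (d - j)))"
      unfolding split by (rule sum.union_disjoint) auto
    also have "(\<Sum>j=J..d. card (H j (d - j))) = (\<Sum>j=J..d. card (H J (d - j)))"
      unfolding H_def by (intro sum.cong) (auto dest: J)
    also have "\<dots> = (\<Sum>t\<le>d - J. card (H J t))"
      using \<open>J \<le> d\<close>
      by (intro sum.reindex_bij_witness[of _ "\<lambda>t. d - t" "\<lambda>j. d - j"]) auto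
    finally show "card {\<mu>\<in>C. sum \<mu> (insert a F) \<le> d}
        = (\<Sum>j<J. card (H j (d - j))) + (\<Sum>t\<le>d - J. card (H J t))"
      by (simp add: card)
  qed
  then show ?case by (simp add: decomp IH(1))
qed

section \<open>Comparison of degrees through growth\<close>

lemma poly_map_poly_of_rat: "poly (map_poly of_rat p) (of_rat x) = (of_rat (poly p x) :: real)"
  by (induction p) (simp_all add: map_poly_pCons of_rat_add of_rat_mult)

text \<open>If \<open>p\<close> had the larger degree, the sign of its leading coefficient would
  decide: either \<open>p - q\<close> or \<open>- p\<close> is eventually positive, and both
  contradict the bounds.\<close>

lemma degree_le_of_nat_bounds:
  fixes p q :: "rat poly"
  assumes "\<forall>\<^sub>F i in sequentially. 0 \<le> poly p (of_nat i) \<and> poly p (of_nat i) \<le> poly q (of_nat i)"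
  shows "degree p \<le> degree q"
proof (rule ccontr)
  assume less: "\<not> degree p \<le> degree q"
  have unbounded: "\<exists>N. \<forall>i\<ge>N. 0 < poly s (of_nat i)" if pos: "lead_coeff s > 0" for s :: "rat poly"
  proof -
    \<comment> \<open>Over the reals the growth theorem \<open>poly_pinfty_gt_lc\<close> applies;
      positivity is then pulled back to the rationals.\<close>
    let ?s = "map_poly of_rat s :: real poly"
    have lc: "lead_coeff ?s = of_rat (lead_coeff s)"
      by (simp add: degree_map_poly coeff_map_poly)
    then obtain B where B: "\<And>x. x \<ge> B \<Longrightarrow> lead_coeff ?s \<le> poly ?s x"
      using poly_pinfty_gt_lc[of ?s] pos by auto
    obtain N where N: "B \<le> real N" using real_arch_simple by blast
    have "0 < poly s (of_nat i)" if "i \<ge> N" for i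
    proof -
      have "of_rat 0 < (of_rat (lead_coeff s) :: real)" using pos by (simp only: of_rat_less)
      also have "\<dots> \<le> poly ?s (of_rat (of_nat i))"
        using B[of "of_nat i"] N that by (simp add: lc)
      finally have "of_rat 0 < (of_rat (poly s (of_nat i)) :: real)"
        by (simp only: poly_map_poly_of_rat)
      then show ?thesis by (simp only: of_rat_less)
    qed
    then show ?thesis by blast
  qed
  obtain M where M: "\<And>i. i \<ge> M \<Longrightarrow> 0 \<le> poly p (of_nat i) \<and> poly p (of_nat i) \<le> poly q (of_nat i)"
    using assms unfolding eventually_sequentially by blast
  have "lead_coeff p \<noteq> 0" using less by auto
  then consider "lead_coeff p > 0" | "lead_coeff (- p) > 0" by (metis degree_minus coeff_minus neg_0_less_iff_less neqE)
  then show False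
  proof cases
    case 1
    then have "lead_coeff (p - q) > 0"
      using less lead_coeff_add_le[of "- q" p] by (simp add: not_le)
    from unbounded[OF this] obtain N where "\<And>i. i \<ge> N \<Longrightarrow> 0 < poly (p - q) (of_nat i)" by blast
    from this[of "max N M"] M[of "max N M"] show False by simp
  next
    case 2
    from unbounded[OF this] obtain N where "\<And>i. i \<ge> N \<Longrightarrow> 0 < poly (- p) (of_nat i)" by blast
    from this[of "max N M"] M[of "max N M"] show False by simp
  qed
qed

section \<open>Standard monomials\<close>

context vector_space
begin

lemma independent_family:
  assumes "finite X" and zero: "\<And>c x. (\<Sum>x\<in>X. c x *s w x) = 0 \<Longrightarrow> x \<in> X \<Longrightarrow> c x = 0"
  shows "inj_on w X" "independent (w ` X)"
proof -
  show inj: "inj_on w X"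
  proof (rule inj_onI, rule ccontr)
    fix x y assume xy: "x \<in> X" "y \<in> X" "w x = w y" "x \<noteq> y"
    define c where "c = (\<lambda>z. if z = x then 1 else if z = y then - 1 else 0 :: 'a)"
    have "(\<Sum>z\<in>X. c z *s w z) = (\<Sum>z\<in>{x, y}. c z *s w z)"
      using assms(1) xy by (intro sum.mono_neutral_right) (auto simp: c_def)
    also have "\<dots> = 0" using xy by (simp add: c_def)
    finally show False using zero[of c x] xy by (simp add: c_def)
  qed
  show "independent (w ` X)"
  proof (rule independent_if_scalars_zero)
    fix f y assume *: "(\<Sum>y\<in>w ` X. f y *s y) = 0" "y \<in> w ` X"
    then show "f y = 0" using zero[of "f \<circ> w"] by (auto simp: sum.reindex[OF inj])
  qed (use assms(1) in simp)
qed

text \<open>The finite set \<open>W\<close> forces a basis of \<open>V\<close> to be finite;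
  otherwise the cardinality that defines \<open>dim\<close> would say nothing about size.\<close>

lemma card_le_dim_of_independent:
  assumes "finite W" "V \<subseteq> span W" "B \<subseteq> V" "independent B"
  shows "card B \<le> dim V"
proof -
  obtain C where C: "C \<subseteq> V" "independent C" "V \<subseteq> span C" "card C = dim V"
    by (rule basis_exists)
  then have "finite C" using independent_span_bound[OF assms(1), of C] assms(2) by auto
  then show ?thesis using independent_span_bound[of C B] C assms by auto
qed

text \<open>A projection with kernel \<open>S\<close> stands in for the quotient map: a basis of
  \<open>S\<close> is extended to the whole space, its members are sent to 0 and the added vectors
  are fixed.\<close>

lemma subspace_is_kernel:
  assumes "subspace S"
  obtains \<pi> where "Vector_Spaces.linear scale scale \<pi>" "\<And>x. \<pi> x = 0 \<longleftrightarrow> x \<in> S"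
proof -
  interpret pair: vector_space_pair scale scale ..
  obtain B where B: "B \<subseteq> S" "independent B" "S \<subseteq> span B" by (rule basis_exists)
  define E where "E = extend_basis B"
  have E: "B \<subseteq> E" "independent E" "span E = UNIV"
    using B by (simp_all add: E_def extend_basis_superset independent_extend_basis)
  have S: "S = span B" using B assms by (simp add: span_minimal subset_antisym)
  define \<pi> where "\<pi> = pair.construct E (\<lambda>b. if b \<in> B then 0 else b)"
  have lin: "Vector_Spaces.linear scale scale \<pi>" unfolding \<pi>_def by (rule pair.linear_construct[OF E(2)])
  have basis: "\<pi> b = (if b \<in> B then 0 else b)" if "b \<in> E" for b
    unfolding \<pi>_def by (rule pair.construct_basis[OF E(2) that])
  have zero: "\<pi> x = 0" if "x \<in> span B" for x
    by (rule pair.linear_eq_0_on_span[OF lin _ that]) (use basis E in auto)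
  have id: "\<pi> x = x" if "x \<in> span (E - B)" for x
    by (rule pair.linear_eq_on[OF lin _ that, of "\<lambda>x. x"]) (use basis in \<open>auto intro: linear_ident\<close>)
  have "x \<in> S" if "\<pi> x = 0" for x
  proof -
    have "x \<in> span ((E - B) \<union> B)" using E by (simp add: Un_absorb2)
    then obtain y z where x: "x = y + z" "y \<in> span (E - B)" "z \<in> span B"
      unfolding span_Un by blast
    then have "y = 0" using that id zero by (simp add: pair.linear_add[OF lin])
    then show ?thesis using x S by simp
  qed
  then show thesis using that lin zero S by blast
qed

text \<open>Steinitz exchange in the quotient by \<open>S\<close>: the last hypothesis makes the
  images of the \<open>w x\<close> independent there, and they lie in the span of the image of
  \<open>W\<close>.\<close>

lemma card_le_modulo_subspace:
  assumes "subspace S" "finite X" "finite W" "w ` X \<subseteq> span (W \<union> S)"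
    and zero: "\<And>c x. (\<Sum>x\<in>X. c x *s w x) \<in> S \<Longrightarrow> x \<in> X \<Longrightarrow> c x = 0"
  shows "card X \<le> card W"
proof -
  interpret pair: vector_space_pair scale scale ..
  obtain \<pi> where \<pi>: "Vector_Spaces.linear scale scale \<pi>" "\<And>x. \<pi> x = 0 \<longleftrightarrow> x \<in> S"
    using subspace_is_kernel[OF assms(1)] by blast
  have "c x = 0" if "(\<Sum>x\<in>X. c x *s (\<pi> \<circ> w) x) = 0" "x \<in> X" for c x
    using that zero[of c x] \<pi>(2)[of "\<Sum>x\<in>X. c x *s w x"]
    by (simp add: pair.linear_sum[OF \<pi>(1)] pair.linear_scale[OF \<pi>(1)])
  then have ind: "inj_on (\<pi> \<circ> w) X" "independent ((\<pi> \<circ> w) ` X)"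
    using independent_family[OF assms(2), of "\<pi> \<circ> w"] by blast+
  have "(\<pi> \<circ> w) ` X \<subseteq> span (\<pi> ` W)"
  proof
    fix y assume "y \<in> (\<pi> \<circ> w) ` X"
    then obtain x where x: "x \<in> span (W \<union> S)" "y = \<pi> x" using assms(4) by auto
    then obtain a b where "x = a + b" "a \<in> span W" "b \<in> span S" unfolding span_Un by blast
    moreover have "\<pi> b = 0" if "b \<in> span S" for b
      using that \<pi>(2) assms(1) by (simp add: span_eq_iff[THEN iffD2])
    moreover have "\<pi> ` span W = span (\<pi> ` W)"
      by (rule pair.linear_span_image[OF \<pi>(1), symmetric])
    ultimately show "y \<in> span (\<pi> ` W)"
      using x by (auto simp: pair.linear_add[OF \<pi>(1)])
  qed
  then have "card ((\<pi> \<circ> w) ` X) \<le> card (\<pi> ` W)"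
    using independent_span_bound[OF _ ind(2), of "\<pi> ` W"] assms(3) by blast
  then show ?thesis
    using card_image[OF ind(1)] card_image_le[OF assms(3), of \<pi>] by simp
qed

end

section \<open>Standard exponents and reduction to them\<close>

lemma bump_induct:
  fixes \<mu> \<nu> :: "'g::finite \<Rightarrow> nat"
  assumes "\<mu> \<le> \<nu>" "P \<mu>" "\<And>\<rho> g. P \<rho> \<Longrightarrow> P (bump \<rho> g)"
  shows "P \<nu>"
  using assms(1,2)
proof (induction "\<Sum>g\<in>UNIV. \<nu> g - \<mu> g" arbitrary: \<mu>)
  case 0
  then have "\<And>g. \<nu> g - \<mu> g = 0" by simp
  then have "\<mu> = \<nu>" using 0 by (simp add: le_fun_def fun_eq_iff le_antisym)
  then show ?case using 0 by simp
next
  case (Suc n)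
  then obtain g where g: "\<mu> g < \<nu> g"
    by (metis (no_types, lifting) Zero_not_Suc diff_is_0_eq not_le sum.neutral)
  have "(\<Sum>h\<in>UNIV. \<nu> h - \<mu> h) = Suc (\<Sum>h\<in>UNIV. \<nu> h - (bump \<mu> g) h)"
    using g by (simp add: sum.remove[of UNIV g])
  then show ?case
    using Suc g assms(3) by (intro Suc.hyps(1)[of "bump \<mu> g"]) (auto simp: le_fun_def)
qed

lemma ex_bump:
  assumes "\<mu> g \<noteq> 0"
  obtains \<nu> where "\<mu> = bump \<nu> g"
  using that[of "\<mu>(g := \<mu> g - 1)"] assms by (auto simp: fun_eq_iff)

text \<open>
  \<open>v \<mu>\<close> is the image of the monomial \<open>\<mu>\<close> of an algebra whose associated graded algebra is a polynomial
  ring, and \<open>T g\<close> is the multiplication by the generator \<open>g\<close>, on either side. The submodule \<open>S\<close> plays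
  the role of the ideal in the theory of Groebner bases: exponents are nonstandard if they are leading
  exponents of relations modulo \<open>S\<close>.
\<close>

locale monomial_family = vector_space scale
  for scale :: "'k::field \<Rightarrow> 'm::ab_group_add \<Rightarrow> 'm" +
  fixes v :: "('g::finite \<Rightarrow> nat) \<Rightarrow> 'm" and T :: "'g \<Rightarrow> 'm \<Rightarrow> 'm" and S :: "'m set"
  assumes T_add: "T g (a + b) = T g a + T g b"
    and T_scale: "T g (scale c a) = scale c (T g a)"
    and T_v: "T g (v \<mu>) - v (bump \<mu> g) \<in> span (v ` exps (sum \<mu> UNIV))"
    and subspace_S: "subspace S"
    and T_S: "a \<in> S \<Longrightarrow> T g a \<in> S"
begin

definition rank :: "('g \<Rightarrow> nat) \<Rightarrow> nat" where
  "rank = (SOME r. inj r \<and> (\<forall>\<mu> \<nu>. sum \<mu> UNIV < sum \<nu> UNIV \<longrightarrow> r \<mu> < r \<nu>) \<and>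
     (\<forall>\<mu> \<nu> g. r \<mu> < r \<nu> \<longrightarrow> r (bump \<mu> g) < r (bump \<nu> g)))"

lemma rank:
  "inj rank" "sum \<mu> UNIV < sum \<nu> UNIV \<Longrightarrow> rank \<mu> < rank \<nu>"
  "rank \<mu> < rank \<nu> \<Longrightarrow> rank (bump \<mu> g) < rank (bump \<nu> g)"
proof -
  have "\<exists>r :: ('g \<Rightarrow> nat) \<Rightarrow> nat. inj r \<and> (\<forall>\<mu> \<nu>. sum \<mu> UNIV < sum \<nu> UNIV \<longrightarrow> r \<mu> < r \<nu>) \<and>
     (\<forall>\<mu> \<nu> g. r \<mu> < r \<nu> \<longrightarrow> r (bump \<mu> g) < r (bump \<nu> g))"
    by (rule graded_order_exists) blast
  note * = someI_ex[OF this, folded rank_def]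
  show "inj rank" "sum \<mu> UNIV < sum \<nu> UNIV \<Longrightarrow> rank \<mu> < rank \<nu>"
    "rank \<mu> < rank \<nu> \<Longrightarrow> rank (bump \<mu> g) < rank (bump \<nu> g)"
    using * by blast+
qed

lemma sum_le_of_rank_le: "rank \<mu> \<le> rank \<nu> \<Longrightarrow> sum \<mu> UNIV \<le> sum \<nu> UNIV"
  using rank(2)[of \<nu> \<mu>] by linarith

definition smaller :: "('g \<Rightarrow> nat) \<Rightarrow> 'm set" where
  "smaller \<mu> = span (v ` {\<nu>. rank \<nu> < rank \<mu>} \<union> S)"

definition standard :: "('g \<Rightarrow> nat) set" where
  "standard = {\<mu>. v \<mu> \<notin> smaller \<mu>}"

lemma T_v_lower: "T g (v \<mu>) - v (bump \<mu> g) \<in> smaller (bump \<mu> g)"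
proof -
  have "rank \<nu> < rank (bump \<mu> g)" if "\<nu> \<in> exps (sum \<mu> UNIV)" for \<nu>
    by (rule rank(2)) (use that in \<open>simp add: exps_def sum_bump del: fun_upd_apply\<close>)
  then have "v ` exps (sum \<mu> UNIV) \<subseteq> v ` {\<nu>. rank \<nu> < rank (bump \<mu> g)} \<union> S" by blast
  from span_mono[OF this] T_v[of g \<mu>] show ?thesis unfolding smaller_def by blast
qed

lemma smaller_mono: "rank \<mu> \<le> rank \<nu> \<Longrightarrow> smaller \<mu> \<subseteq> smaller \<nu>"
  unfolding smaller_def by (intro span_mono) auto

text \<open>The order is compatible with \<open>bump\<close>, so applying \<open>T g\<close> to a
  term below \<open>\<mu>\<close> gives a leading term below \<open>bump \<mu> g\<close> and a
  remainder lower still; terms in \<open>S\<close> stay in \<open>S\<close>.\<close>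

lemma T_smaller: "a \<in> smaller \<mu> \<Longrightarrow> T g a \<in> smaller (bump \<mu> g)"
  unfolding smaller_def[of \<mu>]
proof (induction rule: span_induct_alt)
  case base
  show ?case using T_scale[of g 0 0] by (simp add: smaller_def span_zero)
next
  case (step c x y)
  have "T g x \<in> smaller (bump \<mu> g)"
  proof (cases "x \<in> S")
    case True
    then show ?thesis unfolding smaller_def by (intro span_base) (simp add: T_S)
  next
    case False
    then obtain \<nu> where \<nu>: "rank \<nu> < rank \<mu>" "x = v \<nu>" using step by blast
    have "v (bump \<nu> g) \<in> smaller (bump \<mu> g)"
      unfolding smaller_def using rank(3)[OF \<nu>(1), of g] by (intro span_base) blast
    moreover have "T g (v \<nu>) - v (bump \<nu> g) \<in> smaller (bump \<mu> g)"
      using T_v_lower smaller_mono[of "bump \<nu> g" "bump \<mu> g"] rank(3)[OF \<nu>(1), of g] by fastforce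
    ultimately have "(T g (v \<nu>) - v (bump \<nu> g)) + v (bump \<nu> g) \<in> smaller (bump \<mu> g)"
      unfolding smaller_def by (rule span_add[rotated])
    then show ?thesis by (simp add: \<nu>)
  qed
  then show ?case
    using step unfolding T_add T_scale smaller_def by (intro span_add span_scale)
qed

text \<open>Applying \<open>T g\<close> to a relation with leading exponent \<open>\<mu>\<close>
  yields one with leading exponent \<open>bump \<mu> g\<close>.\<close>

lemma bump_not_standard:
  assumes "\<mu> \<notin> standard"
  shows "bump \<mu> g \<notin> standard"
proof -
  have "T g (v \<mu>) \<in> smaller (bump \<mu> g)"
    using T_smaller assms by (simp add: standard_def)
  from span_diff[OF this[unfolded smaller_def] T_v_lower[of g \<mu>, unfolded smaller_def]]
  show ?thesis by (simp add: standard_def smaller_def)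
qed

lemma not_standard_mono: "\<mu> \<notin> standard \<Longrightarrow> \<mu> \<le> \<nu> \<Longrightarrow> \<nu> \<notin> standard"
  by (rule bump_induct[where P = "\<lambda>\<rho>. \<rho> \<notin> standard"]) (auto dest: bump_not_standard)

lemma down_closed_standard: "down_closed standard"
  unfolding down_closed_def using not_standard_mono by blast

text \<open>Reduction to normal form: a nonstandard monomial is, modulo \<open>S\<close>, a
  combination of monomials of smaller rank, and induction on the rank stops at standard
  ones.\<close>

lemma v_in_span_standard: "v \<mu> \<in> span (v ` {\<nu>\<in>standard. rank \<nu> \<le> rank \<mu>} \<union> S)"
proof (induction "rank \<mu>" arbitrary: \<mu> rule: less_induct)
  case less
  show ?case
  proof (cases "\<mu> \<in> standard")
    case True
    then show ?thesis by (intro span_base) auto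
  next
    case False
    have "v ` {\<nu>. rank \<nu> < rank \<mu>} \<union> S \<subseteq> span (v ` {\<nu>\<in>standard. rank \<nu> \<le> rank \<mu>} \<union> S)"
    proof
      fix x assume "x \<in> v ` {\<nu>. rank \<nu> < rank \<mu>} \<union> S"
      then consider \<nu> where "rank \<nu> < rank \<mu>" "x = v \<nu>" | "x \<in> S" by blast
      then show "x \<in> span (v ` {\<nu>\<in>standard. rank \<nu> \<le> rank \<mu>} \<union> S)"
      proof cases
        case 1
        have "v ` {\<rho>\<in>standard. rank \<rho> \<le> rank \<nu>} \<union> S \<subseteq> v ` {\<nu>\<in>standard. rank \<nu> \<le> rank \<mu>} \<union> S"
          using 1 by auto
        from span_mono[OF this] less[OF 1(1)] 1(2) show ?thesis by blast
      qed (auto intro: span_base)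
    qed
    from span_minimal[OF this subspace_span] False show ?thesis
      unfolding standard_def smaller_def by blast
  qed
qed

text \<open>Since \<open>rank\<close> refines the total degree, reduction to normal form never
  raises the degree.\<close>

lemma v_exps_subset_span_standard: "v ` exps d \<subseteq> span (v ` (standard \<inter> exps d) \<union> S)"
proof
  fix x assume "x \<in> v ` exps d"
  then obtain \<mu> where \<mu>: "\<mu> \<in> exps d" "x = v \<mu>" by blast
  have "v ` {\<nu>\<in>standard. rank \<nu> \<le> rank \<mu>} \<union> S \<subseteq> v ` (standard \<inter> exps d) \<union> S"
    using \<mu>(1) sum_le_of_rank_le[of _ \<mu>] by (fastforce simp: exps_def)
  from span_mono[OF this] v_in_span_standard[of \<mu>] \<mu>(2)
  show "x \<in> span (v ` (standard \<inter> exps d) \<union> S)" by blast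
qed

text \<open>The exponent of greatest rank in the support of the relation is nonstandard: dividing by
  its coefficient expresses its monomial through smaller ones and \<open>S\<close>.\<close>

lemma ex_not_standard:
  assumes "(\<Sum>\<mu>\<in>exps d. scale (c \<mu>) (v \<mu>)) \<in> S" "\<mu>1 \<in> exps d" "c \<mu>1 \<noteq> 0"
  obtains \<mu>0 where "\<mu>0 \<notin> standard"
proof -
  define C where "C = {\<mu> \<in> exps d. c \<mu> \<noteq> 0}"
  have C: "finite C" "C \<noteq> {}" using assms by (auto simp: C_def finite_exps)
  then have "Max (rank ` C) \<in> rank ` C" by simp
  then obtain \<mu>0 where "\<mu>0 \<in> C" "Max (rank ` C) = rank \<mu>0" by auto
  then have \<mu>0: "\<mu>0 \<in> C" "\<And>\<mu>. \<mu> \<in> C \<Longrightarrow> rank \<mu> \<le> rank \<mu>0"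
    using Max_ge[of "rank ` C"] C by auto
  have less: "rank \<mu> < rank \<mu>0" if "\<mu> \<in> C" "\<mu> \<noteq> \<mu>0" for \<mu>
    using \<mu>0(2)[OF that(1)] that(2) rank(1) by (metis injD le_neq_implies_less)
  have "(\<Sum>\<mu>\<in>exps d. scale (c \<mu>) (v \<mu>)) = (\<Sum>\<mu>\<in>C. scale (c \<mu>) (v \<mu>))"
    unfolding C_def by (rule sum.mono_neutral_right) (auto simp: finite_exps)
  also have "\<dots> = scale (c \<mu>0) (v \<mu>0) + (\<Sum>\<mu>\<in>C - {\<mu>0}. scale (c \<mu>) (v \<mu>))"
    by (rule sum.remove[OF C(1) \<mu>0(1)])
  finally have "scale (c \<mu>0) (v \<mu>0)
      = (\<Sum>\<mu>\<in>exps d. scale (c \<mu>) (v \<mu>)) - (\<Sum>\<mu>\<in>C - {\<mu>0}. scale (c \<mu>) (v \<mu>))" by simp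
  also have "\<dots> \<in> smaller \<mu>0"
    unfolding smaller_def
  proof (rule span_diff[OF span_base span_sum])
    fix \<mu> assume "\<mu> \<in> C - {\<mu>0}"
    then have "v \<mu> \<in> v ` {\<nu>. rank \<nu> < rank \<mu>0} \<union> S" using less by blast
    then show "scale (c \<mu>) (v \<mu>) \<in> span (v ` {\<nu>. rank \<nu> < rank \<mu>0} \<union> S)"
      by (intro span_scale span_base)
  qed (use assms(1) in blast)
  finally have "scale (inverse (c \<mu>0)) (scale (c \<mu>0) (v \<mu>0)) \<in> smaller \<mu>0"
    unfolding smaller_def by (rule span_scale)
  then have "\<mu>0 \<notin> standard" using \<mu>0(1) by (simp add: standard_def C_def)
  then show thesis by (rule that)
qed

text \<open>Vectors are adjoined in increasing rank. Standardness says precisely that the new one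
  lies outside the span of everything of smaller rank, hence of its predecessors.\<close>

lemma standard_independent:
  assumes "S = {0}" "finite X" "X \<subseteq> standard"
  shows "inj_on v X \<and> independent (v ` X)"
  using assms(2,3)
proof (induction X rule: finite_ranking_induct[where f = rank])
  case (insert x X)
  show ?case
  proof (cases "x \<in> X")
    case False
    have "rank y < rank x" if "y \<in> X" for y
      using insert.hyps(2)[OF that] that False rank(1) by (metis injD le_neq_implies_less)
    then have "v ` X \<subseteq> v ` {\<nu>. rank \<nu> < rank x} \<union> S" by blast
    from span_mono[OF this] have "v x \<notin> span (v ` X)"
      using insert.prems unfolding standard_def smaller_def by blast
    moreover from this have "v x \<notin> v ` X" by (auto intro: span_base)
    ultimately show ?thesis
      using insert False independent_insertI[of "v x" "v ` X"] by auto
  qed (use insert in \<open>simp add: insert_absorb\<close>)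
qed (simp add: independent_empty)

lemma dim_span_exps:
  assumes "S = {0}"
  shows "dim (span (v ` exps d)) = card (standard \<inter> exps d)"
proof -
  note ind = standard_independent[OF assms, of "standard \<inter> exps d"]
  have "span (v ` exps d) \<subseteq> span (v ` (standard \<inter> exps d))"
    using v_exps_subset_span_standard[of d] assms
    by (intro span_minimal subspace_span) (simp add: span_insert_0)
  moreover have "span (v ` (standard \<inter> exps d)) \<subseteq> span (v ` exps d)"
    by (intro span_mono) auto
  ultimately have "span (v ` (standard \<inter> exps d)) = span (v ` exps d)" by blast
  then show ?thesis
    using dim_eq_card[of "v ` (standard \<inter> exps d)" "v ` exps d"] ind
    by (simp add: finite_exps card_image)
qed

lemma eventually_poly_dim:
  assumes "S = {0}"
  shows "eventually_poly (\<lambda>d. dim (span (v ` exps d)))"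
proof -
  have "{\<mu>\<in>standard. sum \<mu> UNIV \<le> d} = standard \<inter> exps d" for d
    by (auto simp: exps_def)
  then show ?thesis
    using down_closed_hilbert[OF _ down_closed_standard, of UNIV]
    unfolding dim_span_exps[OF assms] by simp
qed

end

section \<open>Monomials of the Weyl algebra\<close>

interpretation weyl: algebra_over_field "weyl_scale :: 'k::field \<Rightarrow> ('n, 'k) weyl \<Rightarrow> ('n, 'k) weyl"
  by (rule algebra_over_field_weyl)

lemma weyl_gen_UNIV: "(UNIV :: 'n weyl_gen set) = range Var \<union> range Der"
proof -
  have "g \<in> range Var \<union> range Der" for g :: "'n weyl_gen" by (cases g) auto
  then show ?thesis by blast
qed

instance weyl_gen :: (finite) finite
  by standard (simp add: weyl_gen_UNIV)

lemma sum_weyl_gen: "sum \<mu> UNIV = (\<Sum>i\<in>UNIV. \<mu> (Var i)) + (\<Sum>i\<in>UNIV. \<mu> (Der (i :: 'n::finite)))"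
proof -
  have "sum \<mu> UNIV = sum \<mu> (range Var) + sum \<mu> (range Der)"
    unfolding weyl_gen_UNIV by (rule sum.union_disjoint) auto
  then show ?thesis by (simp add: sum.reindex inj_def)
qed

lemma card_weyl_gen: "CARD('n weyl_gen) = 2 * CARD('n::finite)"
  using sum_weyl_gen[of "\<lambda>_ :: 'n weyl_gen. 1 :: nat"] by simp

definition var_power :: "('n::finite \<Rightarrow> nat) \<Rightarrow> ('n, 'k::field) weyl" where
  "var_power \<alpha> = Finite_Set.fold (\<lambda>i a. weyl_var i ^ \<alpha> i * a) 1 UNIV"

definition der_power :: "('n::finite \<Rightarrow> nat) \<Rightarrow> ('n, 'k::field) weyl" where
  "der_power \<beta> = Finite_Set.fold (\<lambda>i a. weyl_der i ^ \<beta> i * a) 1 UNIV"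

lemma weyl_monomial_eq: "weyl_monomial \<alpha> \<beta> = var_power \<alpha> * der_power \<beta>"
  by (simp add: weyl_monomial_def var_power_def der_power_def)

text \<open>Commutativity lets the factor at \<open>i\<close> be split off first; the product over
  the other indices does not see the change at \<open>i\<close>.\<close>

lemma fold_powers_bump:
  fixes x :: "'n::finite \<Rightarrow> 'a::monoid_mult"
  assumes "\<And>\<alpha>. comp_fun_commute (\<lambda>i a. x i ^ \<alpha> i * a)"
  shows "Finite_Set.fold (\<lambda>j a. x j ^ bump \<alpha> i j * a) 1 UNIV
    = x i * Finite_Set.fold (\<lambda>j a. x j ^ \<alpha> j * a) 1 UNIV"
proof -
  have rec: "Finite_Set.fold (\<lambda>j a. x j ^ \<alpha> j * a) 1 UNIV
      = x i ^ \<alpha> i * Finite_Set.fold (\<lambda>j a. x j ^ \<alpha> j * a) 1 (UNIV - {i})" for \<alpha>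
    by (rule comp_fun_commute_on.fold_rec[OF assms[unfolded comp_fun_commute_def']]) simp_all
  have "Finite_Set.fold (\<lambda>j a. x j ^ bump \<alpha> i j * a) 1 (UNIV - {i})
      = Finite_Set.fold (\<lambda>j a. x j ^ \<alpha> j * a) 1 (UNIV - {i})"
    by (rule Finite_Set.fold_cong[where S = UNIV])
      (use assms in \<open>simp_all add: comp_fun_commute_def'\<close>)
  then show ?thesis
    unfolding rec[of "bump \<alpha> i"] rec[of \<alpha>] by (simp add: mult.assoc)
qed

lemma fold_identity: "Finite_Set.fold (\<lambda>j a. a) z (UNIV :: 'n::finite set) = z"
proof -
  interpret comp_fun_commute "\<lambda>(j :: 'n) (a :: 'a). a" by standard auto
  have "Finite_Set.fold (\<lambda>j a. a) z A = z" for A :: "'n set"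
    using finite[of A] by (induction A rule: finite_induct) simp_all
  then show ?thesis .
qed

lemma var_power_bump: "var_power (bump \<alpha> i) = weyl_var i * var_power \<alpha>"
  unfolding var_power_def by (rule fold_powers_bump) (rule comp_fun_commute_weyl_powers)

lemma der_power_bump: "der_power (bump \<beta> i) = weyl_der i * der_power \<beta>"
  unfolding der_power_def by (rule fold_powers_bump) (rule comp_fun_commute_weyl_powers)

lemma var_power_zero: "var_power (\<lambda>_. 0) = 1"
  by (simp add: var_power_def fold_identity)

lemma der_power_zero: "der_power (\<lambda>_. 0) = 1"
  by (simp add: der_power_def fold_identity)

lemma exponent_induct [case_names zero bump]:
  fixes \<alpha> :: "'g::finite \<Rightarrow> nat"
  assumes "P (\<lambda>_. 0)" "\<And>\<rho> g. P \<rho> \<Longrightarrow> P (bump \<rho> g)"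
  shows "P \<alpha>"
  by (rule bump_induct[of "\<lambda>_. 0" \<alpha> P, OF _ assms]) (simp add: le_fun_def)

abbreviation lower :: "('g \<Rightarrow> nat) \<Rightarrow> 'g \<Rightarrow> 'g \<Rightarrow> nat" where
  "lower \<mu> g \<equiv> \<mu>(g := \<mu> g - 1)"

text \<open>Leibniz rule, by moving the derivation past one variable at a time. The cutoff in
  \<open>lower\<close> at 0 is harmless because the coefficient vanishes there.\<close>

lemma der_var_power:
  fixes \<alpha> :: "'n::finite \<Rightarrow> nat"
  shows "(weyl_der i * var_power \<alpha> :: ('n, 'k::field) weyl)
    = var_power \<alpha> * weyl_der i + weyl_scale (of_nat (\<alpha> i)) (var_power (lower \<alpha> i))"
proof (induction \<alpha> rule: exponent_induct)
  case zero
  show ?case by (simp add: var_power_zero)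
next
  case (bump \<alpha> j)
  let ?p = "var_power :: ('n \<Rightarrow> nat) \<Rightarrow> ('n, 'k) weyl"
  have "weyl_der i * ?p (bump \<alpha> j) = (weyl_der i * weyl_var j) * ?p \<alpha>"
    by (simp only: var_power_bump mult.assoc)
  also have "\<dots> = weyl_var j * (weyl_der i * ?p \<alpha>) + (if i = j then ?p \<alpha> else 0)"
    by (simp add: weyl_relations(3)[of i j] distrib_right mult.assoc)
  also have "\<dots> = ?p (bump \<alpha> j) * weyl_der i
      + (weyl_scale (of_nat (\<alpha> i)) (?p (bump (lower \<alpha> i) j)) + (if i = j then ?p \<alpha> else 0))"
    unfolding bump by (simp only: var_power_bump distrib_left mult.assoc weyl.scale_mult_right add.assoc)
  also have "weyl_scale (of_nat (\<alpha> i)) (?p (bump (lower \<alpha> i) j)) + (if i = j then ?p \<alpha> else 0)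
      = weyl_scale (of_nat (bump \<alpha> j i)) (?p (lower (bump \<alpha> j) i))"
  proof (cases "i = j")
    case True
    have "bump (lower \<alpha> i) i = \<alpha>" if "\<alpha> i \<noteq> 0" using that by (auto simp: fun_eq_iff)
    then show ?thesis using True
      by (cases "\<alpha> i = 0") (auto simp: weyl.scale_left_distrib add.commute fun_upd_idem)
  next
    case False
    then show ?thesis by (simp add: fun_upd_twist)
  qed
  finally show ?case .
qed

lemma der_power_var:
  fixes \<beta> :: "'n::finite \<Rightarrow> nat"
  shows "(der_power \<beta> * weyl_var i :: ('n, 'k::field) weyl)
    = weyl_var i * der_power \<beta> + weyl_scale (of_nat (\<beta> i)) (der_power (lower \<beta> i))"
proof (induction \<beta> rule: exponent_induct)
  case zero
  show ?case by (simp add: der_power_zero)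
next
  case (bump \<beta> j)
  let ?p = "der_power :: ('n \<Rightarrow> nat) \<Rightarrow> ('n, 'k) weyl"
  have "?p (bump \<beta> j) * weyl_var i = weyl_der j * (?p \<beta> * weyl_var i)"
    by (simp only: der_power_bump mult.assoc)
  also have "\<dots> = (weyl_der j * weyl_var i) * ?p \<beta>
      + weyl_scale (of_nat (\<beta> i)) (?p (bump (lower \<beta> i) j))"
    unfolding bump by (simp only: der_power_bump distrib_left mult.assoc weyl.scale_mult_right)
  also have "(weyl_der j * weyl_var i) * ?p \<beta>
      = weyl_var i * ?p (bump \<beta> j) + (if j = i then ?p \<beta> else 0)"
    unfolding der_power_bump by (simp add: weyl_relations(3)[of j i] distrib_right mult.assoc)
  also have "weyl_var i * ?p (bump \<beta> j) + (if j = i then ?p \<beta> else 0)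
        + weyl_scale (of_nat (\<beta> i)) (?p (bump (lower \<beta> i) j))
      = weyl_var i * ?p (bump \<beta> j)
        + ((if j = i then ?p \<beta> else 0) + weyl_scale (of_nat (\<beta> i)) (?p (bump (lower \<beta> i) j)))"
    by (rule add.assoc)
  also have "(if j = i then ?p \<beta> else 0) + weyl_scale (of_nat (\<beta> i)) (?p (bump (lower \<beta> i) j))
      = weyl_scale (of_nat (bump \<beta> j i)) (?p (lower (bump \<beta> j) i))"
  proof (cases "i = j")
    case True
    have "bump (lower \<beta> i) i = \<beta>" if "\<beta> i \<noteq> 0" using that by (auto simp: fun_eq_iff)
    then show ?thesis using True
      by (cases "\<beta> i = 0") (auto simp: weyl.scale_left_distrib add.commute fun_upd_idem)
  next
    case False
    then show ?thesis by (simp add: fun_upd_twist)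
  qed
  finally show ?case .
qed

lemma der_power_der:
  fixes \<beta> :: "'n::finite \<Rightarrow> nat"
  shows "(der_power \<beta> * weyl_der i :: ('n, 'k::field) weyl)
    = weyl_der i * der_power \<beta>"
proof (induction \<beta> rule: exponent_induct)
  case zero
  show ?case by (simp add: der_power_zero)
next
  case (bump \<beta> j)
  let ?p = "der_power :: ('n \<Rightarrow> nat) \<Rightarrow> ('n, 'k) weyl"
  have "?p (bump \<beta> j) * weyl_der i = (weyl_der j * weyl_der i) * ?p \<beta>"
    unfolding der_power_bump by (simp add: bump mult.assoc)
  then show ?case
    unfolding weyl_relations(2)[of j i] by (simp only: der_power_bump mult.assoc)
qed

definition generator :: "'n weyl_gen \<Rightarrow> ('n, 'k::field) weyl" where
  "generator g = (case g of Var i \<Rightarrow> weyl_var i | Der i \<Rightarrow> weyl_der i)"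

text \<open>Both exponent vectors are joined into one function on \<open>'n weyl_gen\<close>, so
  that multiplication by a generator is \<open>bump\<close> up to lower terms, as
  \<open>monomial_family\<close> demands.\<close>

definition mon :: "('n::finite weyl_gen \<Rightarrow> nat) \<Rightarrow> ('n, 'k::field) weyl" where
  "mon \<mu> = weyl_monomial (\<lambda>i. \<mu> (Var i)) (\<lambda>i. \<mu> (Der i))"

lemma fun_upd_weyl_gen:
  "(\<lambda>j. (\<mu>(Var i := c)) (Var j)) = (\<lambda>j. \<mu> (Var j))(i := c)"
  "(\<lambda>j. (\<mu>(Var i := c)) (Der j)) = (\<lambda>j. \<mu> (Der j))"
  "(\<lambda>j. (\<mu>(Der i := c)) (Var j)) = (\<lambda>j. \<mu> (Var j))"
  "(\<lambda>j. (\<mu>(Der i := c)) (Der j)) = (\<lambda>j. \<mu> (Der j))(i := c)"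
  by auto

lemma mon_zero: "mon (\<lambda>_. 0) = 1"
  by (simp add: mon_def weyl_monomial_eq var_power_zero der_power_zero)

lemma var_mon: "weyl_var i * mon \<mu> = mon (bump \<mu> (Var i))"
  unfolding mon_def weyl_monomial_eq fun_upd_weyl_gen var_power_bump[of "\<lambda>i. \<mu> (Var i)" i] by (simp add: mult.assoc)

lemma mon_der: "mon \<mu> * weyl_der i = mon (bump \<mu> (Der i))"
  unfolding mon_def weyl_monomial_eq fun_upd_weyl_gen der_power_bump[of "\<lambda>i. \<mu> (Der i)" i]
  by (simp add: mult.assoc der_power_der)

lemma der_mon:
  "weyl_der i * mon \<mu> = mon (bump \<mu> (Der i)) + weyl_scale (of_nat (\<mu> (Var i))) (mon (lower \<mu> (Var i)))"
  unfolding mon_def weyl_monomial_eq fun_upd_weyl_gen der_power_bump[of "\<lambda>i. \<mu> (Der i)" i]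
  by (simp only: mult.assoc[symmetric] der_var_power distrib_right weyl.scale_mult_left)

lemma var_power_var:
  fixes \<alpha> :: "'n::finite \<Rightarrow> nat"
  shows "(var_power \<alpha> * weyl_var i :: ('n, 'k::field) weyl)
    = weyl_var i * var_power \<alpha>"
proof (induction \<alpha> rule: exponent_induct)
  case zero
  show ?case by (simp add: var_power_zero)
next
  case (bump \<alpha> j)
  let ?p = "var_power :: ('n \<Rightarrow> nat) \<Rightarrow> ('n, 'k) weyl"
  have "?p (bump \<alpha> j) * weyl_var i = (weyl_var j * weyl_var i) * ?p \<alpha>"
    unfolding var_power_bump by (simp add: bump mult.assoc)
  then show ?case
    unfolding weyl_relations(1)[of j i] by (simp only: var_power_bump mult.assoc)
qed

lemma mon_var:
  "mon \<mu> * weyl_var i = mon (bump \<mu> (Var i)) + weyl_scale (of_nat (\<mu> (Der i))) (mon (lower \<mu> (Der i)))"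
  unfolding mon_def weyl_monomial_eq fun_upd_weyl_gen var_power_bump[of "\<lambda>i. \<mu> (Var i)" i] var_power_var[symmetric]
  by (simp add: mult.assoc der_power_var distrib_left weyl.scale_mult_right)

text \<open>Restoring normal order costs at most a multiple of some
  \<open>mon (lower \<mu> h)\<close>, whose degree does not exceed that of \<open>\<mu>\<close>.
  Both sides are needed: left ideals occur for the graph, right ideals for the dual graph.\<close>

lemma gen_mon: "generator g * mon \<mu> - mon (bump \<mu> g) \<in> weyl.span (mon ` exps (sum \<mu> UNIV))"
  and mon_gen: "mon \<mu> * generator g - mon (bump \<mu> g) \<in> weyl.span (mon ` exps (sum \<mu> UNIV))"
proof -
  have "lower \<mu> h \<in> exps (sum \<mu> UNIV)" for h
    unfolding exps_def by (simp add: sum_mono)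
  then have *: "weyl_scale c (mon (lower \<mu> h)) \<in> weyl.span (mon ` exps (sum \<mu> UNIV))" for c h
    by (intro weyl.span_scale weyl.span_base imageI)
  show "generator g * mon \<mu> - mon (bump \<mu> g) \<in> weyl.span (mon ` exps (sum \<mu> UNIV))"
  proof (cases g)
    case (Var i)
    then show ?thesis by (simp add: generator_def var_mon weyl.span_zero)
  next
    case (Der i)
    then show ?thesis using * by (simp add: generator_def der_mon del: fun_upd_apply)
  qed
  show "mon \<mu> * generator g - mon (bump \<mu> g) \<in> weyl.span (mon ` exps (sum \<mu> UNIV))"
  proof (cases g)
    case (Var i)
    then show ?thesis using * by (simp add: generator_def mon_var del: fun_upd_apply)
  next
    case (Der i)
    then show ?thesis by (simp add: generator_def mon_der weyl.span_zero)
  qed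
qed

section \<open>The Bernstein filtration and induction along it\<close>

lemma bernstein_eq: "bernstein m = weyl.span (mon ` exps m :: ('n::finite, 'k::field) weyl set)"
proof -
  have "{weyl_monomial \<alpha> \<beta> | \<alpha> \<beta>. sum \<alpha> UNIV + sum \<beta> UNIV \<le> m}
      = (mon ` exps m :: ('n, 'k) weyl set)"
  proof (intro equalityI subsetI)
    fix a :: "('n, 'k) weyl" assume "a \<in> {weyl_monomial \<alpha> \<beta> | \<alpha> \<beta>. sum \<alpha> UNIV + sum \<beta> UNIV \<le> m}"
    then obtain \<alpha> \<beta> where "a = weyl_monomial \<alpha> \<beta>" "sum \<alpha> UNIV + sum \<beta> UNIV \<le> m" by blast
    then have "a = mon (case_weyl_gen \<alpha> \<beta>)" "case_weyl_gen \<alpha> \<beta> \<in> exps m"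
      by (simp_all add: mon_def exps_def sum_weyl_gen)
    then show "a \<in> mon ` exps m" by blast
  next
    fix a :: "('n, 'k) weyl" assume "a \<in> mon ` exps m"
    then show "a \<in> {weyl_monomial \<alpha> \<beta> | \<alpha> \<beta>. sum \<alpha> UNIV + sum \<beta> UNIV \<le> m}"
      unfolding exps_def sum_weyl_gen mon_def by fast
  qed
  then show ?thesis by (simp add: bernstein_def)
qed

lemma subspace_bernstein: "weyl.subspace (bernstein m)"
  unfolding bernstein_eq by (rule weyl.subspace_span)

lemma bernstein_mono: "m \<le> l \<Longrightarrow> bernstein m \<subseteq> bernstein l"
  unfolding bernstein_eq by (intro weyl.span_mono image_mono exps_mono)

lemma mon_in_bernstein: "\<mu> \<in> exps m \<Longrightarrow> mon \<mu> \<in> bernstein m"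
  unfolding bernstein_eq by (intro weyl.span_base imageI)

lemma one_in_bernstein: "1 \<in> bernstein m"
  using mon_in_bernstein[of "\<lambda>_. 0" m] by (simp add: mon_zero exps_def)

lemma gen_bernstein:
  assumes "a \<in> bernstein m"
  shows "generator g * a \<in> bernstein (Suc m)"
proof -
  have *: "generator g * mon \<mu> \<in> bernstein (Suc m)" if "\<mu> \<in> exps m" for \<mu>
  proof -
    have sub: "mon ` exps (sum \<mu> UNIV) \<subseteq> mon ` exps (Suc m)"
      using that by (intro image_mono exps_mono) (simp add: exps_def)
    have "mon (bump \<mu> g) \<in> weyl.span (mon ` exps (Suc m))"
      using bump_in_exps[OF that] by (intro weyl.span_base imageI)
    from weyl.span_add[OF subsetD[OF weyl.span_mono[OF sub] gen_mon[of g]] this]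
    show ?thesis unfolding bernstein_eq by (simp del: fun_upd_apply)
  qed
  from assms have "a \<in> weyl.span (mon ` exps m)" by (simp add: bernstein_eq)
  then show ?thesis
  proof (induction rule: weyl.span_induct_alt)
    case base
    then show ?case by (simp add: weyl.subspace_0[OF subspace_bernstein])
  next
    case (step c x y)
    then have "generator g * x \<in> bernstein (Suc m)" using * by blast
    then show ?case
      using step by (simp add: distrib_left weyl.scale_mult_right
          weyl.subspace_add[OF subspace_bernstein] weyl.subspace_scale[OF subspace_bernstein])
  qed
qed

lemma bernstein_induct_mon:
  assumes "a \<in> bernstein m"
    and "\<And>m. weyl.subspace {a. P m a}" "\<And>m a. P m a \<Longrightarrow> P (Suc m) a"
    and mon: "\<And>\<mu>. P (sum \<mu> UNIV) (mon \<mu>)"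
  shows "P m a"
proof -
  have mono: "P l a" if "P m a" "m \<le> l" for m l a
    using that(2,1) by (induction rule: dec_induct) (auto intro: assms(3))
  have "mon ` exps m \<subseteq> {a. P m a}"
    using mono mon by (auto simp: exps_def)
  from weyl.span_minimal[OF this assms(2)] assms(1) show ?thesis
    by (auto simp: bernstein_eq)
qed

text \<open>A factorization without correction terms: variables are split off on the left first, and
  a derivation only when no variable is left for it to pass.\<close>

lemma mon_left_factor:
  fixes \<mu> :: "'n::finite weyl_gen \<Rightarrow> nat"
  assumes "sum \<mu> UNIV \<noteq> 0"
  obtains g \<nu> where "\<mu> = bump \<nu> g" "mon \<mu> = generator g * (mon \<nu> :: ('n, 'k::field) weyl)"
proof (cases "\<exists>i. \<mu> (Var i) \<noteq> 0")
  case True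
  then obtain i \<nu> where "\<mu> = bump \<nu> (Var i)" using ex_bump by metis
  then show thesis using that[of \<nu> "Var i"] by (simp add: generator_def var_mon)
next
  case False
  then obtain i where "\<mu> (Der i) \<noteq> 0"
    using assms by (auto simp: sum_weyl_gen)
  then obtain \<nu> where \<nu>: "\<mu> = bump \<nu> (Der i)" using ex_bump by metis
  moreover have "\<nu> (Var i) = 0"
    using False \<nu> by (metis fun_upd_other weyl_gen.distinct(1))
  ultimately show thesis using that[of \<nu> "Der i"] by (simp add: generator_def der_mon)
qed

lemma mon_right_factor:
  fixes \<mu> :: "'n::finite weyl_gen \<Rightarrow> nat"
  assumes "sum \<mu> UNIV \<noteq> 0"
  obtains g \<nu> where "\<mu> = bump \<nu> g" "mon \<mu> = (mon \<nu> :: ('n, 'k::field) weyl) * generator g"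
proof (cases "\<exists>i. \<mu> (Der i) \<noteq> 0")
  case True
  then obtain i \<nu> where "\<mu> = bump \<nu> (Der i)" using ex_bump by metis
  then show thesis using that[of \<nu> "Der i"] by (simp add: generator_def mon_der)
next
  case False
  then obtain i where "\<mu> (Var i) \<noteq> 0"
    using assms by (auto simp: sum_weyl_gen)
  then obtain \<nu> where \<nu>: "\<mu> = bump \<nu> (Var i)" using ex_bump by metis
  moreover have "\<nu> (Der i) = 0"
    using False \<nu> by (metis fun_upd_other weyl_gen.distinct(1))
  ultimately show thesis using that[of \<nu> "Var i"] by (simp add: generator_def mon_var)
qed

text \<open>A degree bound on every element of the filtration follows from one on products of
  generators, built up on the left; the version below builds them up on the right.\<close>

lemma bernstein_induct_left [consumes 1, case_names subspace mono one gen]: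
  assumes "a \<in> bernstein m"
    and "\<And>m. weyl.subspace {a. P m a}" "\<And>m a. P m a \<Longrightarrow> P (Suc m) a"
    and "P 0 1" "\<And>m a g. P m a \<Longrightarrow> P (Suc m) (generator g * a)"
  shows "P m a"
  using assms(1-3)
proof (rule bernstein_induct_mon)
  show "P (sum \<mu> UNIV) (mon \<mu>)" for \<mu>
  proof (induction "sum \<mu> UNIV" arbitrary: \<mu>)
    case 0
    then have "\<mu> = (\<lambda>_. 0)" by (simp add: fun_eq_iff)
    then show ?case using assms(4) by (simp add: mon_zero)
  next
    case (Suc n)
    obtain g \<nu> where \<nu>: "\<mu> = bump \<nu> g" "mon \<mu> = generator g * (mon \<nu> :: ('a, 'b) weyl)"
      using mon_left_factor[of \<mu>] Suc(2) by (metis nat.distinct(1))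
    then have "n = sum \<nu> UNIV" using Suc(2) by (simp add: sum_bump del: fun_upd_apply)
    then show ?case using assms(5) Suc(1)[of \<nu>] Suc(2) \<nu>(2) by metis
  qed
qed

lemma bernstein_induct_right [consumes 1, case_names subspace mono one gen]:
  assumes "a \<in> bernstein m"
    and "\<And>m. weyl.subspace {a. P m a}" "\<And>m a. P m a \<Longrightarrow> P (Suc m) a"
    and "P 0 1" "\<And>m a g. P m a \<Longrightarrow> P (Suc m) (a * generator g)"
  shows "P m a"
  using assms(1-3)
proof (rule bernstein_induct_mon)
  show "P (sum \<mu> UNIV) (mon \<mu>)" for \<mu>
  proof (induction "sum \<mu> UNIV" arbitrary: \<mu>)
    case 0
    then have "\<mu> = (\<lambda>_. 0)" by (simp add: fun_eq_iff)
    then show ?case using assms(4) by (simp add: mon_zero)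
  next
    case (Suc n)
    obtain g \<nu> where \<nu>: "\<mu> = bump \<nu> g" "mon \<mu> = (mon \<nu> :: ('a, 'b) weyl) * generator g"
      using mon_right_factor[of \<mu>] Suc(2) by (metis nat.distinct(1))
    then have "n = sum \<nu> UNIV" using Suc(2) by (simp add: sum_bump del: fun_upd_apply)
    then show ?case using assms(5) Suc(1)[of \<nu>] Suc(2) \<nu>(2) by metis
  qed
qed

lemma bernstein_mult:
  assumes "a \<in> bernstein i" "b \<in> bernstein j"
  shows "a * b \<in> bernstein (i + j)"
  using assms(1)
proof (induction rule: bernstein_induct_left)
  case (subspace m)
  show ?case
    by (rule weyl.subspaceI)
      (simp_all add: distrib_right weyl.scale_mult_left weyl.subspace_0[OF subspace_bernstein]
        weyl.subspace_add[OF subspace_bernstein] weyl.subspace_scale[OF subspace_bernstein])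
next
  case (mono m a)
  then show ?case using bernstein_mono[of "m + j" "Suc m + j"] by auto
qed (use assms(2) gen_bernstein in \<open>simp_all add: mult.assoc\<close>)

lemma ex_bernstein: "\<exists>m. a \<in> bernstein m"
proof (induction a rule: weyl_induct)
  case (scalar c)
  show ?case using weyl.subspace_scale[OF subspace_bernstein one_in_bernstein] by blast
next
  case (var i)
  show ?case using gen_bernstein[OF one_in_bernstein, of "Var i"] by (auto simp: generator_def)
next
  case (der i)
  show ?case using gen_bernstein[OF one_in_bernstein, of "Der i"] by (auto simp: generator_def)
next
  case (add a b)
  then obtain l m where "a \<in> bernstein l" "b \<in> bernstein m" by blast
  then have "a \<in> bernstein (max l m)" "b \<in> bernstein (max l m)"
    using bernstein_mono[of l "max l m"] bernstein_mono[of m "max l m"] by auto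
  then show ?case using weyl.subspace_add[OF subspace_bernstein] by blast
next
  case (mult a b)
  then show ?case using bernstein_mult by blast
qed

lemma ex_bernstein_finite:
  assumes "finite G"
  shows "\<exists>m. G \<subseteq> bernstein m"
  using assms
proof (induction G rule: finite_induct)
  case (insert a G)
  then obtain l m where "G \<subseteq> bernstein l" "a \<in> bernstein m" using ex_bernstein by blast
  then have "insert a G \<subseteq> bernstein (max l m)"
    using bernstein_mono[of l "max l m"] bernstein_mono[of m "max l m"] by auto
  then show ?case by blast
qed simp

section \<open>Commutators as formal derivatives\<close>

definition partial_op :: "'n weyl_gen \<Rightarrow> ('n, 'k::field) weyl \<Rightarrow> ('n, 'k) weyl" where
  "partial_op g a = (case g of Var i \<Rightarrow> weyl_der i * a - a * weyl_der i
    | Der i \<Rightarrow> a * weyl_var i - weyl_var i * a)"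

text \<open>The signs of the commutators in \<open>partial_op\<close> are chosen so that variables
  and derivations obey the same formula: the formal partial derivative in the direction
  \<open>g\<close>.\<close>

lemma partial_op_mon: "partial_op g (mon \<mu>) = weyl_scale (of_nat (\<mu> g)) (mon (lower \<mu> g))"
  by (cases g) (simp_all add: partial_op_def var_mon der_mon mon_var mon_der del: fun_upd_apply)

lemma partial_op_sum: "partial_op g (\<Sum>x\<in>X. weyl_scale (c x) (w x)) = (\<Sum>x\<in>X. weyl_scale (c x) (partial_op g (w x)))"
  by (cases g) (simp_all add: partial_op_def sum_distrib_left sum_distrib_right sum_subtractf
      weyl.scale_mult_left weyl.scale_mult_right weyl.scale_right_diff_distrib)

text \<open>
  Commutators with the generators act on monomials as formal partial derivatives. This yields
  both the linear independence of the monomials (\<open>J = 0\<close>) and the simplicity of the algebra.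
\<close>

lemma one_in_ideal:
  fixes c :: "('n::finite weyl_gen \<Rightarrow> nat) \<Rightarrow> 'k::field_char_0"
  assumes add: "\<And>a b. a \<in> J \<Longrightarrow> b \<in> J \<Longrightarrow> a + b \<in> J"
    and left: "\<And>a b. b \<in> J \<Longrightarrow> a * b \<in> J" and right: "\<And>a b. a \<in> J \<Longrightarrow> a * b \<in> J"
    and "(\<Sum>\<mu>\<in>exps d. weyl_scale (c \<mu>) (mon \<mu>)) \<in> J" "\<mu>0 \<in> exps d" "c \<mu>0 \<noteq> 0"
  shows "1 \<in> J"
  using assms(4-6)
proof (induction d arbitrary: c \<mu>0)
  have unit: "1 \<in> J" if "weyl_scale x 1 \<in> J" "x \<noteq> 0" for x
  proof -
    have "weyl_scale (inverse x) 1 * weyl_scale x 1 \<in> J" by (rule left[OF that(1)])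
    then show ?thesis using that(2) by (simp add: weyl.scale_mult_left)
  qed
  {
    case 0
    have "exps 0 = {\<lambda>_ :: 'n weyl_gen. 0 :: nat}" by (auto simp: exps_def)
    then show ?case using 0 unit[of "c (\<lambda>_. 0)"] by (simp add: mon_zero)
  next
    case (Suc d)
    show ?case
    proof (cases "\<exists>\<mu>\<in>exps (Suc d). c \<mu> \<noteq> 0 \<and> \<mu> \<noteq> (\<lambda>_. 0)")
      case False
      then have "\<mu>0 = (\<lambda>_. 0)" using Suc.prems by blast
      have "(\<Sum>\<mu>\<in>exps (Suc d). weyl_scale (c \<mu>) (mon \<mu>)) = (\<Sum>\<mu>\<in>{\<lambda>_. 0}. weyl_scale (c \<mu>) (mon \<mu>))"
        by (rule sum.mono_neutral_right) (use False in \<open>auto simp: finite_exps\<close>, simp add: exps_def)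
      then show ?thesis using unit[of "c (\<lambda>_. 0)"] Suc.prems \<open>\<mu>0 = _\<close> by (simp add: mon_zero)
    next
      case True
      then obtain \<mu> g where \<mu>: "\<mu> \<in> exps (Suc d)" "c \<mu> \<noteq> 0" "\<mu> g \<noteq> 0" by blast
      \<comment> \<open>Differentiating in a direction \<open>g\<close> that occurs in some
        \<open>\<mu>\<close> lowers the degree bound and turns the term at \<open>\<mu>\<close> into
        one at \<open>\<nu>\<close>.\<close>
      obtain \<nu> where \<nu>: "\<mu> = bump \<nu> g" using \<mu>(3) by (rule ex_bump)
      have bump_iff: "bump \<rho> g \<in> exps (Suc d) \<longleftrightarrow> \<rho> \<in> exps d" for \<rho>
        by (simp only: exps_def mem_Collect_eq sum_bump Suc_le_mono)
      have lower_bump: "lower (bump \<rho> g) g = \<rho>" for \<rho> by simp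
      let ?a = "\<Sum>\<mu>\<in>exps (Suc d). weyl_scale (c \<mu>) (mon \<mu>)"
      have uminus: "- a \<in> J" if "a \<in> J" for a using left[OF that, of "- 1"] by simp
      have "a - b \<in> J" if "a \<in> J" "b \<in> J" for a b
        using add[OF that(1) uminus[OF that(2)]] by simp
      then have "partial_op g ?a \<in> J"
        unfolding partial_op_def using left right Suc.prems(1) by (simp split: weyl_gen.split)
      also have "partial_op g ?a
          = (\<Sum>\<mu>\<in>exps (Suc d). weyl_scale (c \<mu> * of_nat (\<mu> g)) (mon (lower \<mu> g)))"
        by (simp add: partial_op_sum partial_op_mon del: fun_upd_apply)
      also have "\<dots> = (\<Sum>\<mu>\<in>(\<lambda>\<rho>. bump \<rho> g) ` exps d. weyl_scale (c \<mu> * of_nat (\<mu> g)) (mon (lower \<mu> g)))"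
      proof (rule sum.mono_neutral_right)
        show "\<forall>\<mu>\<in>exps (Suc d) - (\<lambda>\<rho>. bump \<rho> g) ` exps d.
            weyl_scale (c \<mu> * of_nat (\<mu> g)) (mon (lower \<mu> g)) = 0"
        proof
          fix \<mu> assume *: "\<mu> \<in> exps (Suc d) - (\<lambda>\<rho>. bump \<rho> g) ` exps d"
          have "\<mu> g = 0"
          proof (rule ccontr)
            assume "\<mu> g \<noteq> 0"
            then obtain \<rho> where "\<mu> = bump \<rho> g" by (rule ex_bump)
            then show False using * bump_iff by blast
          qed
          then show "weyl_scale (c \<mu> * of_nat (\<mu> g)) (mon (lower \<mu> g)) = 0" by simp
        qed
      qed (use bump_iff in \<open>auto simp: finite_exps simp del: fun_upd_apply\<close>)
      also have "\<dots> = (\<Sum>\<rho>\<in>exps d. weyl_scale (c (bump \<rho> g) * of_nat (Suc (\<rho> g))) (mon \<rho>))"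
      proof (subst sum.reindex)
        show "inj_on (\<lambda>\<rho>. bump \<rho> g) (exps d)" by (rule inj_onI) (metis lower_bump)
      qed (simp add: lower_bump)
      \<comment> \<open>The new coefficient at \<open>\<nu>\<close> is \<open>c \<mu>\<close> times
        a positive integer, which is nonzero in characteristic zero.\<close>
      finally show ?thesis
        using Suc.IH[of "\<lambda>\<rho>. c (bump \<rho> g) * of_nat (Suc (\<rho> g))" \<nu>] \<mu> \<nu> bump_iff
        by (simp del: of_nat_Suc fun_upd_apply)
    qed
  }
qed

lemma mon_independent:
  "inj_on (mon :: _ \<Rightarrow> ('n::finite, 'k::field_char_0) weyl) (exps d)"
  "weyl.independent (mon ` exps d :: ('n, 'k) weyl set)"
proof -
  have "c \<mu> = 0" if "(\<Sum>\<mu>\<in>exps d. weyl_scale (c \<mu>) (mon \<mu>)) = (0 :: ('n, 'k) weyl)" "\<mu> \<in> exps d" for c \<mu>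
    using one_in_ideal[of "{0}" c d \<mu>] that by auto
  with weyl.independent_family[OF finite_exps, where w = "mon :: _ \<Rightarrow> ('n, 'k) weyl"]
  show "inj_on (mon :: _ \<Rightarrow> ('n::finite, 'k) weyl) (exps d)"
    "weyl.independent (mon ` exps d :: ('n, 'k) weyl set)" by blast+
qed

lemma bernstein_coefficients:
  fixes a :: "('n::finite, 'k::field_char_0) weyl"
  assumes "a \<in> bernstein d"
  obtains c where "a = (\<Sum>\<mu>\<in>exps d. weyl_scale (c \<mu>) (mon \<mu>))"
proof -
  have "a \<in> range (\<lambda>u. \<Sum>x\<in>mon ` exps d. weyl_scale (u x) x)"
    using assms weyl.span_finite[of "mon ` exps d :: ('n, 'k) weyl set"] by (simp add: bernstein_eq finite_exps)
  then obtain u where "a = (\<Sum>x\<in>mon ` exps d. weyl_scale (u x) x)" by blast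
  then show thesis using that[of "\<lambda>\<mu>. u (mon \<mu>)"] by (simp add: sum.reindex[OF mon_independent(1)])
qed

section \<open>Degree growth under an endomorphism, and simplicity\<close>

lemma endomorphism_bernstein:
  fixes f :: "('n::finite, 'k::field) weyl \<Rightarrow> ('n, 'k) weyl"
  assumes "algebra_endomorphism weyl_scale f"
  obtains c where "c \<noteq> 0" "\<And>g. f (generator g) \<in> bernstein c"
    "\<And>m a. a \<in> bernstein m \<Longrightarrow> f a \<in> bernstein (c * m)"
proof -
  interpret f: Vector_Spaces.linear weyl_scale weyl_scale f
    using assms by (simp add: algebra_endomorphism_def)
  have f_mult: "f (a * b) = f a * f b" and f_1: "f 1 = 1" for a b
    using assms by (simp_all add: algebra_endomorphism_def)
  obtain c0 where "range (\<lambda>g. f (generator g)) \<subseteq> bernstein c0"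
    using ex_bernstein_finite[of "range (\<lambda>g. f (generator g))"] by auto
  \<comment> \<open>The successor makes the bound positive, so that its filtration step contains the
    generators as well.\<close>
  then have c: "f (generator g) \<in> bernstein (Suc c0)" for g
    using bernstein_mono[of c0 "Suc c0"] by auto
  have "f a \<in> bernstein (Suc c0 * m)" if "a \<in> bernstein m" for a m
    using that
  proof (induction rule: bernstein_induct_left)
    case (subspace m)
    show ?case
      by (rule weyl.subspaceI)
        (simp_all add: f.zero f.add f.scale weyl.subspace_0[OF subspace_bernstein]
          weyl.subspace_add[OF subspace_bernstein] weyl.subspace_scale[OF subspace_bernstein])
  next
    case (mono m a)
    then show ?case using bernstein_mono[of "Suc c0 * m" "Suc c0 * Suc m"] by auto
  next
    case one
    show ?case by (simp add: f_1 one_in_bernstein)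
  next
    case (gen m a g)
    from bernstein_mult[OF c[of g] gen] show ?case by (simp add: f_mult)
  qed
  then show thesis using that c by blast
qed

text \<open>Leaving \<open>T\<close> open lets one counting argument serve left ideals and right
  ideals; the hypotheses on \<open>f\<close> make the preimage of \<open>S\<close> a two-sided
  ideal.\<close>

lemma simplicity_criterion:
  fixes f :: "('n::finite, 'k::field_char_0) weyl \<Rightarrow> ('n, 'k) weyl"
  assumes f: "algebra_endomorphism weyl_scale f"
    and S: "monomial_family weyl_scale mon T S"
    and ideal: "\<And>a b. f b \<in> S \<Longrightarrow> f (a * b) \<in> S" "\<And>a b. f a \<in> S \<Longrightarrow> f (a * b) \<in> S"
    and "1 \<notin> S"
  shows "S = {0}"
proof (rule ccontr)
  interpret monomial_family weyl_scale mon T S by (rule S)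
  interpret f: Vector_Spaces.linear weyl_scale weyl_scale f
    using f by (simp add: algebra_endomorphism_def)
  have f_1: "f 1 = 1"
    using f by (simp add: algebra_endomorphism_def)
  assume "S \<noteq> {0}"
  then obtain a where a: "a \<in> S" "a \<noteq> 0" using weyl.subspace_0[OF subspace_S] by blast
  obtain d where "a \<in> bernstein d" using ex_bernstein by blast
  then obtain c where c: "a = (\<Sum>\<mu>\<in>exps d. weyl_scale (c \<mu>) (mon \<mu>))"
    by (rule bernstein_coefficients)
  then obtain \<mu>1 where "\<mu>1 \<in> exps d" "c \<mu>1 \<noteq> 0"
    using a(2) by (metis (no_types, lifting) weyl.scale_zero_left sum.neutral)
  then obtain \<mu>0 where \<mu>0: "\<mu>0 \<notin> standard"
    using ex_not_standard[of c d \<mu>1] a(1) c by blast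
  obtain e where e: "\<And>m a. a \<in> bernstein m \<Longrightarrow> f a \<in> bernstein (e * m)"
    by (rule endomorphism_bernstein[OF f]) (rule that)
  let ?N = "CARD('n weyl_gen)"
  define K where "K = sum \<mu>0 UNIV"
  \<comment> \<open>Images of monomials of degree at most \<open>?N * m\<close> stay independent
    modulo \<open>S\<close> and lie, modulo \<open>S\<close>, in the span of standard monomials of
    degree at most \<open>e * (?N * m)\<close>. Those avoid the cone above
    \<open>\<mu>0\<close>.\<close>
  have bound: "Suc m ^ ?N \<le> K * Suc (e * (?N * m)) ^ (?N - 1)" for m
  proof -
    let ?X = "exps (?N * m) :: ('n weyl_gen \<Rightarrow> nat) set"
    let ?W = "standard \<inter> exps (e * (?N * m))"
    have "card ?X \<le> card (mon ` ?W :: ('n, 'k) weyl set)"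
    proof (rule weyl.card_le_modulo_subspace[OF subspace_S])
      show "(f \<circ> mon) ` ?X \<subseteq> weyl.span (mon ` ?W \<union> S)"
      proof
        fix y assume "y \<in> (f \<circ> mon) ` ?X"
        then have "y \<in> bernstein (e * (?N * m))"
          using e mon_in_bernstein by auto
        then have "y \<in> weyl.span (mon ` exps (e * (?N * m)))" by (simp add: bernstein_eq)
        then show "y \<in> weyl.span (mon ` ?W \<union> S)"
          using weyl.span_minimal[OF v_exps_subset_span_standard weyl.subspace_span] by blast
      qed
      fix x \<mu> assume *: "(\<Sum>\<mu>\<in>?X. weyl_scale (x \<mu>) ((f \<circ> mon) \<mu>)) \<in> S" "\<mu> \<in> ?X"
      \<comment> \<open>A relation modulo \<open>S\<close> among the images gives an element of the
        preimage of \<open>S\<close>; a nonzero coefficient would put 1 into that ideal and so into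
        \<open>S\<close>.\<close>
      then have "(\<Sum>\<mu>\<in>?X. weyl_scale (x \<mu>) (mon \<mu>)) \<in> f -` S"
        by (simp add: f.sum f.scale)
      then show "x \<mu> = 0"
        using one_in_ideal[of "f -` S" x "?N * m" \<mu>] *(2) ideal \<open>1 \<notin> S\<close>
        by (auto simp: f.add f_1 weyl.subspace_add[OF subspace_S])
    qed (simp_all add: finite_exps)
    also have "\<dots> \<le> card ?W" by (rule card_image_le) (simp add: finite_exps)
    also have "\<dots> \<le> card {\<mu> \<in> exps (e * (?N * m)). \<not> \<mu>0 \<le> \<mu>}"
      using not_standard_mono[OF \<mu>0] by (intro card_mono) (auto simp: finite_exps)
    also have "\<dots> \<le> K * Suc (e * (?N * m)) ^ (?N - 1)"
      unfolding K_def by (rule card_exps_not_ge)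
    finally show ?thesis using card_exps_lower[of m, where 'g = "'n weyl_gen"] by linarith
  qed
  \<comment> \<open>With \<open>e * (?N * m) + 1\<close> bounded by
    \<open>(e * ?N + 1) * (m + 1)\<close>, this choice reduces the bound to
    \<open>Suc m * Suc m ^ (?N - 1) \<le> m * Suc m ^ (?N - 1)\<close>.\<close>
  define m where "m = K * Suc (e * ?N) ^ (?N - 1)"
  have "Suc m * Suc m ^ (?N - 1) = Suc m ^ ?N"
    by (metis power_eq_if card_gt_0_iff finite UNIV_not_empty less_numeral_extra(3))
  also have "\<dots> \<le> K * Suc (e * (?N * m)) ^ (?N - 1)" by (rule bound)
  also have "\<dots> \<le> K * (Suc (e * ?N) * Suc m) ^ (?N - 1)"
    by (intro mult_left_mono power_mono) (auto simp: algebra_simps)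
  also have "\<dots> = m * Suc m ^ (?N - 1)"
    unfolding power_mult_distrib by (simp add: m_def)
  finally show False by simp
qed

section \<open>Graphs of endomorphisms\<close>

lemma monomial_family_weyl:
  assumes "weyl.subspace S"
  shows "(\<And>a g. a \<in> S \<Longrightarrow> generator g * a \<in> S) \<Longrightarrow> monomial_family weyl_scale mon (\<lambda>g a. generator g * a) S"
    and "(\<And>a g. a \<in> S \<Longrightarrow> a * generator g \<in> S) \<Longrightarrow> monomial_family weyl_scale mon (\<lambda>g a. a * generator g) S"
  by unfold_locales
    (simp_all add: distrib_left distrib_right weyl.scale_mult_left weyl.scale_mult_right gen_mon mon_gen assms
      del: fun_upd_apply)

context
  fixes f :: "('n::finite, 'k::field_char_0) weyl \<Rightarrow> ('n, 'k) weyl"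
  assumes f: "algebra_endomorphism weyl_scale f"
begin

lemma endomorphism_rules:
  "f (a + b) = f a + f b" "f (weyl_scale c a) = weyl_scale c (f a)" "f (a * b) = f a * f b" "f 1 = 1"
proof -
  interpret f: Vector_Spaces.linear weyl_scale weyl_scale f
    using f by (simp add: algebra_endomorphism_def)
  show "f (a + b) = f a + f b" "f (weyl_scale c a) = weyl_scale c (f a)"
    by (rule f.add, rule f.scale)
  show "f (a * b) = f a * f b" "f 1 = 1"
    using f by (simp_all add: algebra_endomorphism_def)
qed

lemma bimodule_graph:
  "bimodule weyl_scale weyl_scale (\<lambda>a x. a * x) (\<lambda>x s. x * f s)"
  by unfold_locales
    (simp_all add: endomorphism_rules distrib_left distrib_right mult.assoc
      weyl.scale_mult_left weyl.scale_mult_right)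

lemma bimodule_dual_graph:
  "bimodule weyl_scale weyl_scale (\<lambda>a x. f a * x) (\<lambda>x s. x * s)"
  by unfold_locales
    (simp_all add: endomorphism_rules distrib_left distrib_right mult.assoc
      weyl.scale_mult_left weyl.scale_mult_right)

lemma simple_graph:
  "simple_bimodule weyl_scale weyl_scale (\<lambda>a x. a * x) (\<lambda>x s. x * f s)"
  unfolding simple_bimodule_def
proof (intro conjI allI impI)
  show "(UNIV :: ('n, 'k) weyl set) \<noteq> {0}" by (metis UNIV_I singletonD zero_neq_one)
  fix S assume "sub_bimodule weyl_scale (\<lambda>a x. a * x) (\<lambda>x s. x * f s) S"
  then have S: "weyl.subspace S" "\<And>a u. u \<in> S \<Longrightarrow> a * u \<in> S" "\<And>a u. u \<in> S \<Longrightarrow> u * f a \<in> S"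
    by (simp_all add: sub_bimodule_def)
  show "S = {0} \<or> S = UNIV"
  proof (cases "1 \<in> S")
    case True
    then have "a \<in> S" for a using S(2)[of 1 a] by simp
    then show ?thesis by blast
  next
    case False
    have "S = {0}"
    proof (rule simplicity_criterion[OF f monomial_family_weyl(1)[OF S(1)]])
      show "f (a * b) \<in> S" if "f b \<in> S" for a b
        using S(2)[OF that] by (simp add: endomorphism_rules)
      show "f (a * b) \<in> S" if "f a \<in> S" for a b
        using S(3)[OF that] by (simp add: endomorphism_rules)
    qed (fact S(2), fact False)
    then show ?thesis by blast
  qed
qed (rule bimodule_graph)

lemma simple_dual_graph:
  "simple_bimodule weyl_scale weyl_scale (\<lambda>a x. f a * x) (\<lambda>x s. x * s)"
  unfolding simple_bimodule_def
proof (intro conjI allI impI)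
  show "(UNIV :: ('n, 'k) weyl set) \<noteq> {0}" by (metis UNIV_I singletonD zero_neq_one)
  fix S assume "sub_bimodule weyl_scale (\<lambda>a x. f a * x) (\<lambda>x s. x * s) S"
  then have S: "weyl.subspace S" "\<And>a u. u \<in> S \<Longrightarrow> f a * u \<in> S" "\<And>a u. u \<in> S \<Longrightarrow> u * a \<in> S"
    by (simp_all add: sub_bimodule_def)
  show "S = {0} \<or> S = UNIV"
  proof (cases "1 \<in> S")
    case True
    then have "a \<in> S" for a using S(3)[of 1 a] by simp
    then show ?thesis by blast
  next
    case False
    have "S = {0}"
    proof (rule simplicity_criterion[OF f monomial_family_weyl(2)[OF S(1)]])
      show "f (a * b) \<in> S" if "f b \<in> S" for a b
        using S(2)[OF that] by (simp add: endomorphism_rules)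
      show "f (a * b) \<in> S" if "f a \<in> S" for a b
        using S(3)[OF that] by (simp add: endomorphism_rules)
    qed (fact S(3), fact False)
    then show ?thesis by blast
  qed
qed (rule bimodule_dual_graph)

end

section \<open>Hilbert polynomials by comparison with the Bernstein filtration\<close>

lemma dim_bernstein_lower:
  fixes V :: "('n::finite, 'k::field_char_0) weyl set"
  assumes "bernstein i \<subseteq> V" "V \<subseteq> bernstein j"
  shows "card (exps i :: ('n weyl_gen \<Rightarrow> nat) set) \<le> weyl.dim V"
proof -
  have "card (mon ` exps i :: ('n, 'k) weyl set) \<le> weyl.dim V"
  proof (rule weyl.card_le_dim_of_independent)
    show "V \<subseteq> weyl.span (mon ` exps j)" using assms(2) by (simp add: bernstein_eq)
    show "mon ` exps i \<subseteq> V" using assms(1) mon_in_bernstein by blast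
  qed (simp_all add: finite_exps mon_independent(2))
  then show ?thesis by (simp add: card_image[OF mon_independent(1)])
qed

lemma dim_bernstein_upper:
  fixes V :: "('n::finite, 'k::field) weyl set"
  assumes "V \<subseteq> bernstein j"
  shows "weyl.dim V \<le> Suc j ^ CARD('n weyl_gen)"
proof -
  have "weyl.dim V \<le> card (mon ` exps j :: ('n, 'k) weyl set)"
    using assms by (intro weyl.dim_le_card) (simp_all add: bernstein_eq finite_exps)
  also have "\<dots> \<le> card (exps j :: ('n weyl_gen \<Rightarrow> nat) set)"
    by (rule card_image_le[OF finite_exps])
  also note card_exps_upper
  finally show ?thesis .
qed

text \<open>The graph and the dual graph are both treated through this locale, with \<open>'m = 'n + 'n\<close>.\<close>

locale comparable_action = left_module act
  for act :: "('m::finite, 'k::field_char_0) weyl \<Rightarrow> ('n::finite, 'k) weyl \<Rightarrow> ('n, 'k) weyl" +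
  fixes e :: nat
  assumes act_scalar: "act (weyl_scale c 1) u = weyl_scale c u"
    and act_gen: "u \<in> bernstein j \<Longrightarrow> act (generator g) u \<in> bernstein (e + j)"
    and bernstein_generated: "a \<in> bernstein j \<Longrightarrow> \<exists>b\<in>bernstein j. act b 1 = a"
    and card_index: "CARD('m) = CARD('n weyl_gen)"
begin

lemma act_zero: "act 0 u = 0" "act a 0 = 0"
  using act_add_left[of 0 0 u] act_add_right[of a 0 0] by simp_all

lemma act_minus: "act (- a) u = - act a u"
  using act_add_left[of a "- a" u] by (simp add: act_zero eq_neg_iff_add_eq_0 add.commute)

lemma act_diff: "act (a - b) u = act a u - act b u"
  using act_add_left[of a "- b" u] by (simp add: act_minus)

lemma act_scale_left: "act (weyl_scale c a) u = weyl_scale c (act a u)"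
  using act_mult[of "weyl_scale c 1" a u] by (simp add: act_scalar weyl.scale_mult_left)

lemma act_scale_right: "act a (weyl_scale c u) = weyl_scale c (act a u)"
proof -
  have "act a (weyl_scale c u) = act (a * weyl_scale c 1) u" by (simp only: act_mult act_scalar)
  then show ?thesis by (simp add: weyl.scale_mult_right act_scale_left)
qed

lemma act_sum_right: "act a (\<Sum>x\<in>X. w x) = (\<Sum>x\<in>X. act a (w x))"
  by (induction X rule: infinite_finite_induct) (simp_all add: act_zero act_add_right)

lemma act_bernstein:
  assumes "b \<in> bernstein i" "u \<in> bernstein j"
  shows "act b u \<in> bernstein (e * i + j)"
  using assms(1)
proof (induction rule: bernstein_induct_left)
  case (subspace m)
  show ?case
    by (rule weyl.subspaceI)
      (simp_all add: act_zero act_add_left act_scale_left weyl.subspace_0[OF subspace_bernstein]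
        weyl.subspace_add[OF subspace_bernstein] weyl.subspace_scale[OF subspace_bernstein])
next
  case (mono m a)
  then show ?case using bernstein_mono[of "e * m + j" "e * Suc m + j"] by auto
next
  case one
  show ?case using assms(2) by (simp add: act_one)
next
  case (gen m a g)
  from act_gen[OF gen] show ?case by (simp add: act_mult add.assoc)
qed

lemma filtration_singleton: "module_filtration act {u} i = (\<lambda>b. act b u) ` bernstein i"
  by (auto simp: module_filtration_def)

lemma scalar_action: "(\<lambda>c. act (weyl_scale c 1)) = weyl_scale"
  by (simp add: fun_eq_iff act_scalar)

text \<open>The monomials are already evaluated at \<open>u\<close>, so the relation space is
  \<open>{0}\<close> and the nonstandard exponents are the leading exponents of annihilators of
  \<open>u\<close>.\<close>

lemma monomial_family_act:
  "monomial_family weyl_scale (\<lambda>\<mu>. act (mon \<mu>) u) (\<lambda>g. act (generator g)) {0}"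
proof
  fix g and \<mu> :: "'m weyl_gen \<Rightarrow> nat"
  interpret lin: Vector_Spaces.linear weyl_scale weyl_scale "\<lambda>a. act a u"
    by unfold_locales (simp_all add: act_add_left act_scale_left)
  have "act (generator g * mon \<mu> - mon (bump \<mu> g)) u
      \<in> (\<lambda>a. act a u) ` weyl.span (mon ` exps (sum \<mu> UNIV))"
    by (intro imageI gen_mon)
  then show "act (generator g) (act (mon \<mu>) u) - act (mon (bump \<mu> g)) u
      \<in> weyl.span ((\<lambda>\<mu>. act (mon \<mu>) u) ` exps (sum \<mu> UNIV))"
    by (simp add: act_diff act_mult lin.span_image[symmetric] image_image del: fun_upd_apply)
qed (simp_all add: act_add_right act_scale_right act_zero)

lemma hilbert_polynomial_exists: "\<exists>p. hilbert_polynomial act {1} p"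
proof -
  interpret monomial_family weyl_scale "\<lambda>\<mu>. act (mon \<mu>) 1" "\<lambda>g. act (generator g)" "{0}"
    by (rule monomial_family_act)
  interpret lin: Vector_Spaces.linear weyl_scale weyl_scale "\<lambda>a. act a 1"
    by unfold_locales (simp_all add: act_add_left act_scale_left)
  have "module_filtration act {1} d = weyl.span ((\<lambda>\<mu>. act (mon \<mu>) 1) ` exps d)" for d
    by (simp add: filtration_singleton bernstein_eq lin.span_image[symmetric] image_image)
  then show ?thesis
    using eventually_poly_dim
    by (simp add: hilbert_polynomial_def scalar_action eventually_poly_def)
qed

text \<open>The filtration is squeezed between Bernstein steps: \<open>bernstein i\<close> lies in
  step \<open>t + i\<close>, and step \<open>i\<close> lies in \<open>bernstein (e * i + s)\<close>.
  Both bounds on the dimension grow with exponent \<open>CARD('m)\<close>.\<close>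

lemma degree_hilbert_polynomial:
  assumes G: "finite_generating_set act G" and p: "hilbert_polynomial act G p"
  shows "degree p = CARD('m)"
proof (rule antisym)
  let ?N = "CARD('m)"
  let ?V = "module_filtration act G"
  have fin: "finite G" using G by (simp add: finite_generating_set_def)
  obtain s where s: "G \<subseteq> bernstein s" using ex_bernstein_finite[OF fin] by blast
  \<comment> \<open>Expressing 1 through \<open>G\<close> bounds the shift: \<open>act b 1\<close>
    has coefficients \<open>b * a g\<close>, and \<open>t\<close> bounds the degrees of the
    \<open>a g\<close>.\<close>
  obtain a where a: "1 = (\<Sum>g\<in>G. act (a g) g)"
    using G unfolding finite_generating_set_def by blast
  obtain t where t: "a ` G \<subseteq> bernstein t" using ex_bernstein_finite[of "a ` G"] fin by blast
  have upper: "?V i \<subseteq> bernstein (e * i + s)" for i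
  proof
    fix x assume "x \<in> ?V i"
    then obtain b where b: "x = (\<Sum>g\<in>G. act (b g) g)" "\<And>g. g \<in> G \<Longrightarrow> b g \<in> bernstein i"
      unfolding module_filtration_def by blast
    show "x \<in> bernstein (e * i + s)"
      unfolding b(1)
      by (rule weyl.subspace_sum[OF subspace_bernstein]) (use act_bernstein[OF b(2)] s in blast)
  qed
  have lower: "bernstein i \<subseteq> ?V (t + i)" for i
  proof
    fix x :: "('n, 'k) weyl" assume "x \<in> bernstein i"
    then obtain b where b: "b \<in> bernstein i" "x = act b 1" using bernstein_generated by blast
    have "x = (\<Sum>g\<in>G. act (b * a g) g)"
      unfolding b(2) by (subst a) (simp add: act_sum_right act_mult)
    moreover have "b * a g \<in> bernstein (t + i)" if "g \<in> G" for g
      using bernstein_mult[OF b(1), of "a g" t] t that by (auto simp: add.commute)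
    ultimately show "x \<in> ?V (t + i)" unfolding module_filtration_def
      by (intro CollectI exI[of _ "\<lambda>g. b * a g"]) simp
  qed
  obtain M where M: "\<And>i. i \<ge> M \<Longrightarrow> of_nat (weyl.dim (?V i)) = poly p (of_nat i)"
    using p unfolding hilbert_polynomial_def scalar_action eventually_sequentially by blast
  have "degree p \<le> degree ([:of_nat (Suc s), of_nat e :: rat:] ^ ?N)"
  proof (rule degree_le_of_nat_bounds, rule eventually_sequentiallyI)
    fix i assume i: "M \<le> i"
    have "of_nat (weyl.dim (?V i)) \<le> (of_nat (Suc (e * i + s) ^ ?N) :: rat)"
      using dim_bernstein_upper[OF upper] by (simp only: of_nat_le_iff card_index)
    then show "0 \<le> poly p (of_nat i) \<and> poly p (of_nat i)
        \<le> poly ([:of_nat (Suc s), of_nat e:] ^ ?N) (of_nat i)"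
      by (simp add: M[OF i, symmetric] algebra_simps)
  qed
  also have "\<dots> \<le> degree [:of_nat (Suc s), of_nat e :: rat:] * ?N" by (rule degree_power_le)
  also have "\<dots> \<le> 1 * ?N" by (intro mult_right_mono) auto
  finally show "degree p \<le> ?N" by simp
  \<comment> \<open>The lower count is available at indices \<open>t + ?N * m\<close>. Substituting
    this nonconstant linear polynomial in \<open>m\<close> preserves the degree of
    \<open>p\<close>.\<close>
  have "degree (monom 1 ?N :: rat poly) \<le> degree (pcompose p [:of_nat t, of_nat ?N:])"
  proof (rule degree_le_of_nat_bounds, rule eventually_sequentiallyI)
    fix m assume "M \<le> m"
    moreover have "1 * m \<le> ?N * m" by (rule mult_right_mono) (simp_all add: Suc_le_eq)
    ultimately have i: "M \<le> t + ?N * m" by linarith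
    have "m ^ ?N \<le> Suc m ^ ?N" by (rule power_mono) auto
    also have "\<dots> \<le> weyl.dim (?V (t + ?N * m))"
      using card_exps_lower[of m, where 'g = "'n weyl_gen"] dim_bernstein_lower[OF lower upper]
      unfolding card_index by (rule order_trans)
    finally have "of_nat (m ^ ?N) \<le> poly p (of_nat (t + ?N * m))"
      unfolding M[OF i, symmetric] by (simp only: of_nat_le_iff)
    then show "0 \<le> poly (monom 1 ?N) (of_nat m :: rat) \<and> poly (monom 1 ?N) (of_nat m)
        \<le> poly (pcompose p [:of_nat t, of_nat ?N:]) (of_nat m)"
      by (simp add: poly_monom poly_pcompose mult.commute)
  qed
  then show "?N \<le> degree p" by (simp add: degree_monom_eq degree_pcompose)
qed

lemma holonomic_act: "holonomic act"
proof -
  have G: "finite_generating_set act {1}"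
    unfolding finite_generating_set_def
  proof (intro conjI allI)
    fix u :: "('n, 'k) weyl"
    obtain j where "u \<in> bernstein j" using ex_bernstein by blast
    then obtain b where "act b 1 = u" using bernstein_generated by blast
    then show "\<exists>a. u = (\<Sum>g\<in>{1}. act (a g) g)" by (intro exI[of _ "\<lambda>_. b"]) simp
  qed simp
  obtain p where p: "hilbert_polynomial act {1} p"
    using hilbert_polynomial_exists by blast
  \<comment> \<open>The set \<open>{1}\<close> supplies a Hilbert polynomial; the degree lemma,
    valid for all finite generating sets, makes the value unique.\<close>
  have "weyl_module_dim act = CARD('m)"
    unfolding weyl_module_dim_def
    by (rule the_equality) (use G p degree_hilbert_polynomial in blast)+
  then show ?thesis
    unfolding holonomic_def using G left_module_axioms by blast
qed

end

section \<open>The two graphs as modules in twice as many variables\<close>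

lemma bimodule_action_rules:
  assumes "bimodule weyl_scale scaleM lact ract"
  shows "is_bimodule_action scaleM lact ract (bimodule_action scaleM lact ract)"
  unfolding bimodule_action_def by (rule theI'[OF ex1_bimodule_action[OF assms]])

lemma card_sum_index: "CARD('n + 'n) = CARD('n::finite weyl_gen)"
  by (simp add: card_weyl_gen card_UNIV_sum)

lemma weyl_gen_sum_cases:
  obtains i where "g = Var (Inl i)" | i where "g = Der (Inl i)"
  | i where "g = Var (Inr i)" | i where "g = Der (Inr i)"
proof (cases g)
  case (Var s)
  then show thesis using that by (cases s) auto
next
  case (Der s)
  then show thesis using that by (cases s) auto
qed

text \<open>The negated generator is included because the derivations in the second half act by
  minus right multiplication.\<close>

lemma comparable_bernstein_gen:
  assumes "left_module act" "b \<in> bernstein m" "act b 1 = a"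
  shows "\<exists>b\<in>bernstein (Suc m). act b 1 = act (generator g) a"
    and "\<exists>b\<in>bernstein (Suc m). act b 1 = act (- generator g) a"
proof -
  have "act (generator g * b) 1 = act (generator g) a" "act (- generator g * b) 1 = act (- generator g) a"
    using left_module.act_mult[OF assms(1)] assms(3) by metis+
  moreover have "generator g * b \<in> bernstein (Suc m)" "- generator g * b \<in> bernstein (Suc m)"
    using gen_bernstein[OF assms(2)] weyl.subspace_neg[OF subspace_bernstein gen_bernstein[OF assms(2)]]
    by simp_all
  ultimately show "\<exists>b\<in>bernstein (Suc m). act b 1 = act (generator g) a"
    "\<exists>b\<in>bernstein (Suc m). act b 1 = act (- generator g) a" by blast+
qed

lemma subspace_cyclic:
  assumes "left_module act" "\<And>c u. act (weyl_scale c 1) u = weyl_scale c u"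
  shows "weyl.subspace {a. \<exists>b\<in>bernstein m. act b 1 = a}"
proof -
  interpret left_module act by fact
  have scale: "act (weyl_scale c a) u = weyl_scale c (act a u)" for c a u
    using act_mult[of "weyl_scale c 1" a u] by (simp add: assms(2) weyl.scale_mult_left)
  interpret Vector_Spaces.linear weyl_scale weyl_scale "\<lambda>a. act a 1"
    by unfold_locales (simp_all add: act_add_left scale)
  have "{a. \<exists>b\<in>bernstein m. act b 1 = a} = (\<lambda>b. act b 1) ` bernstein m" by auto
  then show ?thesis using subspace_image[OF subspace_bernstein] by simp
qed

context
  fixes f :: "('n::finite, 'k::field_char_0) weyl \<Rightarrow> ('n, 'k) weyl"
  assumes f: "algebra_endomorphism weyl_scale f"
begin

lemma endomorphism_bound:
  obtains c where "\<And>g. f (generator g) \<in> bernstein c" "\<And>g. generator g \<in> (bernstein c :: ('n, 'k) weyl set)"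
proof -
  obtain c where "c \<noteq> 0" "\<And>g. f (generator g) \<in> bernstein c"
    by (rule endomorphism_bernstein[OF f]) (rule that)
  moreover from this have "generator g \<in> (bernstein c :: ('n, 'k) weyl set)" for g
    using gen_bernstein[OF one_in_bernstein, of g 0] bernstein_mono[of "Suc 0" c] by auto
  ultimately show thesis using that by blast
qed

lemma holonomic_graph:
  "holonomic_bimodule weyl_scale (\<lambda>a x. a * x) (\<lambda>x s. x * f s)"
proof -
  define act where "act = bimodule_action weyl_scale (\<lambda>a x. a * x) (\<lambda>x s. x * f s)"
  note bimodule = bimodule_graph[OF f]
  note rules = bimodule_action_rules[OF bimodule, folded act_def, unfolded is_bimodule_action_def]
  interpret left_module act using rules by blast
  have scalar: "act (weyl_scale c 1) u = weyl_scale c u" for c u using rules by blast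
  have minus: "act (- a) u = - act a u" for a u
    using act_add_left[of a "- a" u] act_add_left[of 0 0 u]
    by (simp add: eq_neg_iff_add_eq_0 add.commute)
  have gens: "act (generator (Var (Inl i))) u = generator (Var i) * u"
    "act (generator (Der (Inl i))) u = generator (Der i) * u"
    "act (generator (Var (Inr i))) u = u * f (generator (Var i))"
    "act (generator (Der (Inr i))) u = - (u * f (generator (Der i)))" for i u
    using rules by (simp_all add: generator_def)
  obtain c where c: "\<And>g. f (generator g) \<in> bernstein c" "\<And>g. generator g \<in> (bernstein c :: ('n, 'k) weyl set)"
    by (rule endomorphism_bound) (rule that)
  interpret comparable_action act c
  proof
    fix u :: "('n, 'k) weyl" and j g
    assume "u \<in> bernstein j"
    then have "generator (h) * u \<in> bernstein (c + j)" "u * f (generator (h)) \<in> bernstein (c + j)" for h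
      using bernstein_mult[of _ c u j] bernstein_mult[of u j _ c] c by (simp_all add: add.commute)
    then show "act (generator g) u \<in> bernstein (c + j)"
      by (cases g rule: weyl_gen_sum_cases) (simp_all add: gens weyl.subspace_neg[OF subspace_bernstein])
  next
    fix a :: "('n, 'k) weyl" and j
    assume "a \<in> bernstein j"
    then show "\<exists>b\<in>bernstein j. act b 1 = a"
    \<comment> \<open>Left multiplication is untwisted on the graph, so the generators with index
      \<open>Inl i\<close> alone reach every element from 1 without loss of degree.\<close>
    proof (induction rule: bernstein_induct_left)
      case (subspace m)
      show ?case using left_module_axioms scalar by (rule subspace_cyclic)
    next
      case (mono m a)
      then show ?case using bernstein_mono[of m "Suc m"] by auto
    next
      case one
      show ?case using one_in_bernstein act_one by blast
    next
      case (gen m a g)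
      then obtain b where b: "b \<in> bernstein m" "act b 1 = a" by blast
      show ?case
      proof (cases g)
        case (Var i)
        then show ?thesis
          using comparable_bernstein_gen(1)[OF left_module_axioms b, of "Var (Inl i)"] by (simp add: gens)
      next
        case (Der i)
        then show ?thesis
          using comparable_bernstein_gen(1)[OF left_module_axioms b, of "Der (Inl i)"] by (simp add: gens)
      qed
    qed
  qed (rule scalar, rule card_sum_index)
  show ?thesis
    unfolding holonomic_bimodule_def using bimodule holonomic_act by (simp add: act_def)
qed

lemma holonomic_dual_graph:
  "holonomic_bimodule weyl_scale (\<lambda>a x. f a * x) (\<lambda>x s. x * s)"
proof -
  define act where "act = bimodule_action weyl_scale (\<lambda>a x. f a * x) (\<lambda>x s. x * s)"
  note bimodule = bimodule_dual_graph[OF f]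
  note rules = bimodule_action_rules[OF bimodule, folded act_def, unfolded is_bimodule_action_def]
  interpret left_module act using rules by blast
  have scalar: "act (weyl_scale c 1) u = weyl_scale c u" for c u using rules by blast
  have minus: "act (- a) u = - act a u" for a u
    using act_add_left[of a "- a" u] act_add_left[of 0 0 u]
    by (simp add: eq_neg_iff_add_eq_0 add.commute)
  have gens: "act (generator (Var (Inl i))) u = f (generator (Var i)) * u"
    "act (generator (Der (Inl i))) u = f (generator (Der i)) * u"
    "act (generator (Var (Inr i))) u = u * generator (Var i)"
    "act (generator (Der (Inr i))) u = - (u * generator (Der i))" for i u
    using rules by (simp_all add: generator_def)
  obtain c where c: "\<And>g. f (generator g) \<in> bernstein c" "\<And>g. generator g \<in> (bernstein c :: ('n, 'k) weyl set)"
    by (rule endomorphism_bound) (rule that)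
  interpret comparable_action act c
  proof
    fix u :: "('n, 'k) weyl" and j g
    assume "u \<in> bernstein j"
    then have "f (generator (h)) * u \<in> bernstein (c + j)" "u * generator (h) \<in> bernstein (c + j)" for h
      using bernstein_mult[of _ c u j] bernstein_mult[of u j _ c] c by (simp_all add: add.commute)
    then show "act (generator g) u \<in> bernstein (c + j)"
      by (cases g rule: weyl_gen_sum_cases) (simp_all add: gens weyl.subspace_neg[OF subspace_bernstein])
  next
    fix a :: "('n, 'k) weyl" and j
    assume "a \<in> bernstein j"
    then show "\<exists>b\<in>bernstein j. act b 1 = a"
    \<comment> \<open>Here right multiplication is untwisted, so products are built on the right by
      the generators with index \<open>Inr i\<close>.\<close>
    proof (induction rule: bernstein_induct_right)
      case (subspace m)
      show ?case using left_module_axioms scalar by (rule subspace_cyclic)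
    next
      case (mono m a)
      then show ?case using bernstein_mono[of m "Suc m"] by auto
    next
      case one
      show ?case using one_in_bernstein act_one by blast
    next
      case (gen m a g)
      then obtain b where b: "b \<in> bernstein m" "act b 1 = a" by blast
      show ?case
      proof (cases g)
        case (Var i)
        then show ?thesis
          using comparable_bernstein_gen(1)[OF left_module_axioms b, of "Var (Inr i)"] by (simp add: gens)
      next
        case (Der i)
        then show ?thesis
          \<comment> \<open>Negating the generator cancels the sign in the action of
            \<open>Der (Inr i)\<close>.\<close>
          using comparable_bernstein_gen(2)[OF left_module_axioms b, of "Der (Inr i)"]
          by (simp add: gens minus)
      qed
    qed
  qed (rule scalar, rule card_sum_index)
  show ?thesis
    unfolding holonomic_bimodule_def using bimodule holonomic_act by (simp add: act_def)
qed

end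

theorem corollary2p6:
  fixes f :: "('n::finite, 'k::field_char_0) weyl \<Rightarrow> ('n, 'k) weyl"
  assumes "algebra_endomorphism weyl_scale f"
  shows "(holonomic_bimodule weyl_scale (\<lambda>a x. a * x) (\<lambda>x s. x * f s) \<and>
          simple_bimodule weyl_scale weyl_scale (\<lambda>a x. a * x) (\<lambda>x s. x * f s)) \<and>
         (holonomic_bimodule weyl_scale (\<lambda>a x. f a * x) (\<lambda>x s. x * s) \<and>
          simple_bimodule weyl_scale weyl_scale (\<lambda>a x. f a * x) (\<lambda>x s. x * s))"
  using holonomic_graph simple_graph holonomic_dual_graph simple_dual_graph assms by blast

end
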